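(* Let $(X,d_X)$ and $(Y,d_Y)$ be unbounded chain-connected proper metric spaces. The following are equivalent: (1) $\mathcal{SO}(X)$ and $\mathcal{SO}(Y)$ are lattice isomorphic. (2) $\mathcal{SO}^{\ast}(X)$ and $\mathcal{SO}^{\ast}(Y)$ are lattice isomorphic. (3) There exists a coarse homeomorphism between $X$ and $Y$. (4) The Higson compactifications $hX$ and $hY$ are homeomorphic.
   Context: A metric space is proper if all its closed balls are compact. For $r>0$, $X$ is $r$-chain connected if for any $x,x'\in X$ there are finitely many points $p_0=x,p_1,\dots,p_n=x'$ in $X$ with $d_X(p_{i-1},p_i)\le r$ for $i=1,\dots,n$; $X$ is chain-connected if it is $r$-chain connected for some $r>0$. A continuous $f:X\to\mathbb{R}$ on a proper metric space is slowly oscillating if for every $R>0$ and $\varepsilon>0$ there is a compact $K\subset X$ with $\operatorname{diam} f(B_{d_X}(x,R))<\varepsilon$ for every $x\in X\setminus K$, where $B_{d_X}(x,R)$ is the closed ball. $\mathcal{SO}(X)$ is the lattice (pointwise $\wedge=\min$, $\vee=\max$) of all continuous slowly oscillating functions $X\to\mathbb{R}$ and $\mathcal{SO}^{\ast}(X)$ the sublattice of bounded ones. Two lattices are lattice isomorphic if there is a bijection between them preserving $\vee$ and $\wedge$ (not assumed linear). A map $f:X\to Y$ is uniformly expansive if there is a non-decreasing $\sigma:[0,\infty)\to[0,\infty)$ with $d_Y(f(x),f(x'))\le\sigma(d_X(x,x'))$ for all $x,x'\in X$; metrically proper if preimages of bounded sets are bounded; a coarse map if it is both. A homeomorphism $f$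 is a coarse homeomorphism if both $f$ and $f^{-1}$ are coarse maps. The Higson compactification $hX$ of $X$ is the closure of $e(X)$ in the product space $[-\infty,\infty]^{\mathcal{SO}^{\ast}(X)}$, where $[-\infty,\infty]$ has the order topology and $e(x)=(f(x))_{f\in\mathcal{SO}^{\ast}(X)}$ (a topological embedding); equivalently, it is the compactification of $X$, unique up to equivalence, such that $\mathcal{SO}^{\ast}(X)$ is exactly the set of bounded continuous functions on $X$ that extend continuously over it. *)

theory Defs
  imports "HOL-Analysis.Analysis"
begin

definition proper_space :: "'a::metric_space itself \<Rightarrow> bool" where
  "proper_space _ \<longleftrightarrow> (\<forall>(x::'a) r. compact (cball x r))"

definition r_chain_connected :: "real \<Rightarrow> 'a::metric_space set \<Rightarrow> bool" where
  "r_chain_connected r S \<longleftrightarrow>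
     (\<forall>x\<in>S. \<forall>x'\<in>S. \<exists>(n::nat) p.
        p 0 = x \<and> p n = x' \<and> (\<forall>i\<in>{0..n}. p i \<in> S) \<and>
        (\<forall>i\<in>{1..n}. dist (p (i - 1)) (p i) \<le> r))"

definition chain_connected :: "'a::metric_space set \<Rightarrow> bool" where
  "chain_connected S \<longleftrightarrow> (\<exists>r>0. r_chain_connected r S)"

(* diameter is real-valued, with an unspecified value on unbounded sets.  This does not
   matter here: f is continuous and, in a proper space, balls are compact, so the sets
   f ` cball x R are bounded. *)
definition slowly_oscillating :: "('a::metric_space \<Rightarrow> real) \<Rightarrow> bool" where
  "slowly_oscillating f \<longleftrightarrow>
     continuous_on UNIV f \<and>
     (\<forall>R>0. \<forall>\<epsilon>>0. \<exists>K. compact K \<and> (\<forall>x. x \<notin> K \<longrightarrow> diameter (f ` cball x R) < \<epsilon>))"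

definition SO :: "('a::metric_space \<Rightarrow> real) set" where
  "SO = {f. slowly_oscillating f}"

definition SO_bounded :: "('a::metric_space \<Rightarrow> real) set" where
  "SO_bounded = {f \<in> SO. bounded (range f)}"

(* For sublattices A and B of the ambient lattices; on real-valued functions inf and sup
   are the pointwise minimum and maximum. *)
definition lattice_isomorphic :: "'a::lattice set \<Rightarrow> 'b::lattice set \<Rightarrow> bool" where
  "lattice_isomorphic A B \<longleftrightarrow>
     (\<exists>T. bij_betw T A B \<and>
        (\<forall>f\<in>A. \<forall>g\<in>A. T (sup f g) = sup (T f) (T g) \<and> T (inf f g) = inf (T f) (T g)))"

definition uniformly_expansive :: "('a::metric_space \<Rightarrow> 'b::metric_space) \<Rightarrow> bool" where
  "uniformly_expansive f \<longleftrightarrow>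
     (\<exists>\<sigma>::real \<Rightarrow> real. mono_on {0..} \<sigma> \<and> \<sigma> ` {0..} \<subseteq> {0..} \<and>
        (\<forall>x x'. dist (f x) (f x') \<le> \<sigma> (dist x x')))"

definition metrically_proper :: "('a::metric_space \<Rightarrow> 'b::metric_space) \<Rightarrow> bool" where
  "metrically_proper f \<longleftrightarrow> (\<forall>B. bounded B \<longrightarrow> bounded (f -` B))"

definition coarse_map :: "('a::metric_space \<Rightarrow> 'b::metric_space) \<Rightarrow> bool" where
  "coarse_map f \<longleftrightarrow> uniformly_expansive f \<and> metrically_proper f"

definition coarse_homeomorphism :: "('a::metric_space \<Rightarrow> 'b::metric_space) \<Rightarrow> bool" where
  "coarse_homeomorphism f \<longleftrightarrow>
     (\<exists>g. homeomorphism UNIV UNIV f g \<and> coarse_map f \<and> coarse_map g)"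

(* The product of copies of [-\<infinity>,\<infinity>] indexed by SO_bounded; euclidean on ereal is the
   order topology. *)
definition higson_product :: "(('a::metric_space \<Rightarrow> real) \<Rightarrow> ereal) topology" where
  "higson_product = product_topology (\<lambda>_. euclidean) SO_bounded"

definition higson_embedding :: "'a::metric_space \<Rightarrow> (('a \<Rightarrow> real) \<Rightarrow> ereal)" where
  "higson_embedding x = (\<lambda>f\<in>SO_bounded. ereal (f x))"

definition higson_compactification :: "(('a::metric_space \<Rightarrow> real) \<Rightarrow> ereal) topology" where
  "higson_compactification =
     subtopology higson_product (higson_product closure_of (range higson_embedding))"

end

theory Submission
  imports Defs
begin

text \<open>
  Everything rests on recovering a coarse homeomorphism from a lattice isomorphism \<open>T\<close>, and one
  argument serves \<open>SO\<close> and \<open>SO_bounded\<close> alike; it only uses that the lattice lies between the two and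
  is stable under minima, sums and scalar multiples (\<open>osc_lattice\<close>). Subtracting the function
  \<open>T 0\<close> one may assume \<open>T 0 = 0\<close>; write \<open>S\<close> for the inverse. Positivity sets
  \<open>{x. 0 < v x}\<close> of nonnegative functions are then the basic open sets that \<open>T\<close> can see: \<open>T\<close>
  preserves disjointness of them and, although it need not be linear, it is local: \<open>f \<le> g\<close> on
  \<open>{0 < v}\<close> gives \<open>T f \<le> T g\<close> on \<open>{0 < T v}\<close> (\<open>T_local\<close>).

  The heart is a statement about two sequences of small pieces of \<open>Y\<close> that escape to infinity and
  whose mutual distance tends to infinity (\<open>separated_images_not_close\<close>): their counterparts in
  \<open>X\<close> cannot come so close that all slowly oscillating functions fail to tell them apart in the
  limit. Indeed some bounded slowly oscillating \<open>g\<close> is 1 on the first pieces and 0 on the second, so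
  \<open>S g\<close> equals \<open>k = S 1\<close> on the counterparts of the first and 0 on those of the second, and \<open>k\<close>
  would have to tend to 0 along the former. That is impossible (\<open>S_one_not_vanishing\<close>): if \<open>k\<close>
  is tiny on those sets, then inside them there is room for tiny bumps exceeding \<open>k\<close> somewhere; their
  sum \<open>f\<close> vanishes at infinity, hence is slowly oscillating, whereas \<open>T f\<close> is at least 1 at points
  going to infinity and 0 at points a bounded distance away. The nearby points are supplied
  by chain-connectedness.

  This is applied twice. Pieces shrinking to a point \<open>x\<close> cannot have counterparts spreading to
  infinity, so a small enough positivity set around \<open>x\<close> has a bounded image, and compactness yields
  the unique point \<open>\<phi> x\<close> corresponding to \<open>x\<close>; this \<open>\<phi>\<close> is a homeomorphism. And if \<open>\<phi>\<close> moved points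
  at distance at most \<open>R\<close> arbitrarily far apart, small pieces around such pairs would contradict slow
  oscillation of functions on \<open>X\<close>. So \<open>\<phi>\<close> is uniformly expansive, and by symmetry so is its
  inverse; metric properness is automatic for a homeomorphism of proper spaces.

  Conversely, composition with a coarse homeomorphism carries slowly oscillating functions to slowly
  oscillating functions, which gives both lattice isomorphisms and a homeomorphism of the Higson
  compactifications. Finally the bounded slowly oscillating functions on \<open>X\<close> are precisely the
  restrictions of the continuous real functions on \<open>hX\<close> (\<open>continuous_higson_restrict\<close>), so a
  homeomorphism of the compactifications yields an isomorphism of the lattices \<open>SO_bounded\<close>.
\<close>

section \<open>Slowly oscillating functions on proper spaces\<close>

text \<open>
  On a proper space the diameters can be replaced by distances from the centre of the ball, and the
  compact exceptional set by a bounded one.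
\<close>

lemma slowly_oscillating_iff:
  fixes f :: "'a::metric_space \<Rightarrow> real"
  assumes "proper_space TYPE('a)"
  shows "slowly_oscillating f \<longleftrightarrow> continuous_on UNIV f \<and>
    (\<forall>R>0. \<forall>\<epsilon>>0. \<exists>K. bounded K \<and> (\<forall>x y. x \<notin> K \<longrightarrow> dist x y \<le> R \<longrightarrow> dist (f x) (f y) < \<epsilon>))"
    (is "_ \<longleftrightarrow> _ \<and> ?R")
proof (intro iffI conjI)
  assume f: "slowly_oscillating f"
  then show c: "continuous_on UNIV f"
    by (simp add: slowly_oscillating_def)
  show ?R
  proof (intro allI impI)
    fix R \<epsilon> :: real assume "R > 0" "\<epsilon> > 0"
    with f obtain K where K: "compact K" "\<And>x. x \<notin> K \<Longrightarrow> diameter (f ` cball x R) < \<epsilon>"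
      unfolding slowly_oscillating_def by meson
    have "dist (f x) (f y) < \<epsilon>" if "x \<notin> K" "dist x y \<le> R" for x y
    proof -
      have "compact (f ` cball x R)"
        using assms c by (auto simp: proper_space_def intro: compact_continuous_image continuous_on_subset)
      then have "dist (f x) (f y) \<le> diameter (f ` cball x R)"
        using that \<open>R > 0\<close> by (intro diameter_bounded_bound compact_imp_bounded) auto
      with K(2)[OF \<open>x \<notin> K\<close>] show ?thesis by simp
    qed
    then show "\<exists>K. bounded K \<and> (\<forall>x y. x \<notin> K \<longrightarrow> dist x y \<le> R \<longrightarrow> dist (f x) (f y) < \<epsilon>)"
      using K(1) compact_imp_bounded by blast
  qed
next
  assume f: "continuous_on UNIV f \<and> ?R"
  show "slowly_oscillating f"
    unfolding slowly_oscillating_def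
  proof (intro conjI allI impI)
    show "continuous_on UNIV f" using f by simp
    fix R \<epsilon> :: real assume R: "R > 0" and e: "\<epsilon> > 0"
    then obtain K where K: "bounded K" "\<And>x y. x \<notin> K \<Longrightarrow> dist x y \<le> R \<Longrightarrow> dist (f x) (f y) < \<epsilon>/3"
      using f[THEN conjunct2, rule_format, of R "\<epsilon>/3"] by auto
    obtain a e where ae: "K \<subseteq> cball a e" using K(1) bounded_subset_cball by blast
    have "diameter (f ` cball x R) < \<epsilon>" if "x \<notin> cball a e" for x
    proof -
      have "dist (f y) (f z) \<le> 2*\<epsilon>/3" if "y \<in> cball x R" "z \<in> cball x R" for y z
      proof -
        have "x \<notin> K" using ae \<open>x \<notin> cball a e\<close> by blast
        then have "dist (f x) (f y) < \<epsilon>/3" "dist (f x) (f z) < \<epsilon>/3"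
          using K(2) that by auto
        then show ?thesis using dist_triangle3[of "f y" "f z" "f x"] by linarith
      qed
      then have "diameter (f ` cball x R) \<le> 2*\<epsilon>/3"
        using R by (intro diameter_le) (auto simp: dist_norm)
      then show ?thesis using e by simp
    qed
    then show "\<exists>K. compact K \<and> (\<forall>x. x \<notin> K \<longrightarrow> diameter (f ` cball x R) < \<epsilon>)"
      using assms unfolding proper_space_def by blast
  qed
qed

lemma SO_continuous: "f \<in> SO \<Longrightarrow> continuous_on UNIV f"
  by (simp add: SO_def slowly_oscillating_def)

lemma SO_D:
  fixes f :: "'a::metric_space \<Rightarrow> real"
  assumes "proper_space TYPE('a)" "f \<in> SO" "R > 0" "\<epsilon> > 0"
  obtains K where "bounded K" "\<And>x y. x \<notin> K \<Longrightarrow> dist x y \<le> R \<Longrightarrow> dist (f x) (f y) < \<epsilon>"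
  using assms(2-) unfolding SO_def mem_Collect_eq slowly_oscillating_iff[OF assms(1)] by meson

lemma SO_I:
  fixes f :: "'a::metric_space \<Rightarrow> real"
  assumes "proper_space TYPE('a)" "continuous_on UNIV f"
    "\<And>R \<epsilon>. R > 0 \<Longrightarrow> \<epsilon> > 0 \<Longrightarrow> \<exists>K. bounded K \<and> (\<forall>x y. x \<notin> K \<longrightarrow> dist x y \<le> R \<longrightarrow> dist (f x) (f y) < \<epsilon>)"
  shows "f \<in> SO"
  using assms(2-) unfolding SO_def mem_Collect_eq slowly_oscillating_iff[OF assms(1)] by blast

lemma bounded_thickening:
  fixes K :: "'a::metric_space set"
  assumes "bounded K"
  shows "bounded {x. \<exists>y\<in>K. dist x y \<le> R}"
proof -
  obtain a e where "K \<subseteq> cball a e" using assms bounded_subset_cball by blast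
  then have "{x. \<exists>y\<in>K. dist x y \<le> R} \<subseteq> cball a (e + R)"
    by (auto simp: subset_iff) (metis add_mono dist_commute dist_triangle order_trans)
  then show ?thesis by (meson bounded_cball bounded_subset)
qed

lemma proper_bounded_image:
  fixes f :: "'a::metric_space \<Rightarrow> 'b::metric_space"
  assumes "proper_space TYPE('a)" "continuous_on UNIV f" "bounded B"
  shows "bounded (f ` B)"
proof -
  obtain a e where "B \<subseteq> cball a e" using assms(3) bounded_subset_cball by blast
  moreover have "compact (f ` cball a e)"
    using assms by (auto simp: proper_space_def intro: compact_continuous_image continuous_on_subset)
  ultimately show ?thesis by (meson bounded_subset compact_imp_bounded image_mono)
qed

text \<open>
  The main supply of slowly oscillating functions: far away the values are small, so they differ
  little, whatever the scale \<open>R\<close>.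
\<close>

lemma vanishing_at_infinity_SO_bounded:
  fixes f :: "'a::metric_space \<Rightarrow> real"
  assumes "proper_space TYPE('a)" and c: "continuous_on UNIV f"
    and v: "\<And>\<epsilon>. \<epsilon> > 0 \<Longrightarrow> \<exists>K. bounded K \<and> (\<forall>x. x \<notin> K \<longrightarrow> \<bar>f x\<bar> < \<epsilon>)"
  shows "f \<in> SO_bounded"
proof -
  have "f \<in> SO"
  proof (rule SO_I[OF assms(1) c])
    fix R \<epsilon> :: real assume "R > 0" "\<epsilon> > 0"
    then obtain K where K: "bounded K" "\<And>x. x \<notin> K \<Longrightarrow> \<bar>f x\<bar> < \<epsilon>/2"
      using v[of "\<epsilon>/2"] by auto
    have "dist (f x) (f y) < \<epsilon>" if "x \<notin> {x. \<exists>y\<in>K. dist x y \<le> R}" "dist x y \<le> R" for x y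
    proof -
      have "x \<notin> K" "y \<notin> K" using that \<open>R > 0\<close> by force+
      then show ?thesis using K(2)[of x] K(2)[of y] by (auto simp: dist_real_def)
    qed
    then show "\<exists>K. bounded K \<and> (\<forall>x y. x \<notin> K \<longrightarrow> dist x y \<le> R \<longrightarrow> dist (f x) (f y) < \<epsilon>)"
      using bounded_thickening[OF K(1)] by blast
  qed
  moreover have "bounded (range f)"
  proof -
    obtain K where K: "bounded K" "\<And>x. x \<notin> K \<Longrightarrow> \<bar>f x\<bar> < 1"
      using v[of 1] by auto
    obtain a e where ae: "K \<subseteq> cball a e" using K(1) bounded_subset_cball by blast
    have "compact (f ` cball a e)"
      using assms by (auto simp: proper_space_def intro: compact_continuous_image continuous_on_subset)
    then have "bounded (f ` cball a e \<union> ball 0 1)"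
      by (auto intro: compact_imp_bounded)
    moreover have "range f \<subseteq> f ` cball a e \<union> ball 0 1"
      using K(2) ae by (force simp: dist_real_def)
    ultimately show ?thesis by (rule bounded_subset)
  qed
  ultimately show ?thesis by (simp add: SO_bounded_def)
qed

definition tent :: "'a::metric_space \<Rightarrow> real \<Rightarrow> 'a \<Rightarrow> real" where
  "tent a \<delta> = (\<lambda>x. max 0 (1 - dist x a / \<delta>))"

lemma tent_nonneg: "0 \<le> tent a \<delta> x"
  by (simp add: tent_def)

lemma tent_pos: "\<delta> > 0 \<Longrightarrow> 0 < tent a \<delta> x \<longleftrightarrow> dist x a < \<delta>"
  by (simp add: tent_def less_max_iff_disj)

lemma continuous_tent: "continuous_on UNIV (tent a \<delta>)"
  unfolding tent_def by (cases "\<delta> = 0") (auto intro!: continuous_intros)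

lemma bounded_support_SO_bounded:
  fixes f :: "'a::metric_space \<Rightarrow> real"
  assumes "proper_space TYPE('a)" "continuous_on UNIV f" "bounded {x. f x \<noteq> 0}"
  shows "f \<in> SO_bounded"
  by (rule vanishing_at_infinity_SO_bounded[OF assms(1,2)]) (use assms(3) in fastforce)

lemma tent_SO_bounded:
  assumes "proper_space TYPE('a::metric_space)" "\<delta> > 0"
  shows "tent (a::'a) \<delta> \<in> SO_bounded"
proof (rule bounded_support_SO_bounded[OF assms(1) continuous_tent])
  have "{x. tent a \<delta> x \<noteq> 0} \<subseteq> ball a \<delta>"
    using tent_pos[OF assms(2), of a] tent_nonneg[of a \<delta>] by (force simp: dist_commute less_le)
  then show "bounded {x. tent a \<delta> x \<noteq> 0}" by (meson bounded_ball bounded_subset)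
qed

lemma uniform_limit_bounded_support_SO_bounded:
  fixes F :: "nat \<Rightarrow> 'a::metric_space \<Rightarrow> real"
  assumes "proper_space TYPE('a)" "uniform_limit UNIV F f sequentially"
    "\<And>n. continuous_on UNIV (F n)" "\<And>n. bounded {x. F n x \<noteq> 0}"
  shows "f \<in> SO_bounded"
proof (rule vanishing_at_infinity_SO_bounded[OF assms(1)])
  show "continuous_on UNIV f"
    using uniform_limit_theorem[OF _ assms(2)] assms(3) by simp
  fix \<epsilon> :: real assume "\<epsilon> > 0"
  then obtain n where n: "\<And>x. dist (F n x) (f x) < \<epsilon>"
    using assms(2) unfolding uniform_limit_iff eventually_sequentially by blast
  show "\<exists>K. bounded K \<and> (\<forall>x. x \<notin> K \<longrightarrow> \<bar>f x\<bar> < \<epsilon>)"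
  proof (intro exI conjI allI impI)
    show "bounded {x. F n x \<noteq> 0}" by (rule assms(4))
    show "\<bar>f x\<bar> < \<epsilon>" if "x \<notin> {x. F n x \<noteq> 0}" for x
      using n[of x] that by (simp add: dist_real_def)
  qed
qed

text \<open>
  Bumps that are 1 on the unit ball around \<open>y n\<close> and fall off to 0 with slope \<open>1 / (n + 1)\<close>; the \<open>n\<close>-th
  one lives on a ball of radius \<open>n + 2\<close>.
\<close>

definition widening_bump :: "(nat \<Rightarrow> 'a::metric_space) \<Rightarrow> nat \<Rightarrow> 'a \<Rightarrow> real" where
  "widening_bump y n = (\<lambda>z. max 0 (1 - max 0 (dist z (y n) - 1) / (real n + 1)))"

lemma widening_bump_le_1: "widening_bump y n z \<le> 1"
  by (simp add: widening_bump_def)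

lemma widening_bump_nonneg: "0 \<le> widening_bump y n z"
  by (simp add: widening_bump_def)

lemma widening_bump_Lipschitz:
  "widening_bump y n z \<le> widening_bump y n z' + dist z z' / (real n + 1)"
proof -
  have "dist z' (y n) \<le> dist z z' + dist z (y n)"
    using dist_triangle[of z' "y n" z] by (simp add: dist_commute)
  then have "max 0 (dist z' (y n) - 1) \<le> max 0 (dist z (y n) - 1) + dist z z'"
    by auto
  then have "max 0 (dist z' (y n) - 1) / (real n + 1)
      \<le> max 0 (dist z (y n) - 1) / (real n + 1) + dist z z' / (real n + 1)"
    by (simp add: divide_right_mono flip: add_divide_distrib)
  moreover have "0 \<le> dist z z' / (real n + 1)" by simp
  ultimately show ?thesis unfolding widening_bump_def by linarith
qed

lemma widening_bump_eq_0: "dist z (y n) \<ge> real n + 2 \<Longrightarrow> widening_bump y n z = 0"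
  by (simp add: widening_bump_def field_simps)

text \<open>
  Outside the bounded union of the first \<open>N\<close> supports the supremum is \<open>1 / (N + 1)\<close>-Lipschitz, being a
  supremum of such functions.
\<close>

lemma SUP_widening_bump_SO_bounded:
  fixes y :: "nat \<Rightarrow> 'a::metric_space"
  assumes "proper_space TYPE('a)"
  shows "(\<lambda>z. SUP n. widening_bump y n z) \<in> SO_bounded"
proof -
  define g where "g = (\<lambda>z. SUP n. widening_bump y n z)"
  have bdd: "bdd_above (range (\<lambda>n. widening_bump y n z))" for z
    using widening_bump_le_1 by (auto intro!: bdd_aboveI)
  have up: "widening_bump y n z \<le> g z" for n z
    unfolding g_def by (rule cSUP_upper[OF _ bdd]) simp
  have g0: "0 \<le> g z" for z using up[of 0 z] widening_bump_nonneg[of y 0 z] by linarith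
  have g1: "g z \<le> 1" for z unfolding g_def by (rule cSUP_least) (auto simp: widening_bump_le_1)
  have lip: "g z \<le> g z' + dist z z' / (real N + 1)" if "\<And>n. n < N \<Longrightarrow> widening_bump y n z = 0" for N z z'
    unfolding g_def[THEN fun_cong, of z]
  proof (rule cSUP_least)
    fix n
    show "widening_bump y n z \<le> g z' + dist z z' / (real N + 1)"
    proof (cases "n < N")
      case True then show ?thesis using that[of n] g0[of z'] by simp
    next
      case False
      then have "dist z z' / (real n + 1) \<le> dist z z' / (real N + 1)"
        by (intro divide_left_mono) auto
      then show ?thesis using widening_bump_Lipschitz[of y n z z'] up[of n z'] by linarith
    qed
  qed simp
  have "g \<in> SO"
  proof (rule SO_I[OF assms])
    have "dist (g z) (g z') \<le> dist z z'" for z z'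
      using lip[of 0 z z'] lip[of 0 z' z] by (simp add: dist_real_def dist_commute)
    then show "continuous_on UNIV g"
      unfolding continuous_on_iff by (metis le_less_trans dist_commute)
    fix R \<epsilon> :: real assume R: "R > 0" and e: "\<epsilon> > 0"
    obtain N :: nat where "R / \<epsilon> < real N" using reals_Archimedean2 by blast
    then have N: "R / (real N + 1) < \<epsilon>" using e by (simp add: field_simps) 
    define K where "K = (\<Union>n<N. cball (y n) (real n + 2 + R))"
    have "dist (g z) (g z') < \<epsilon>" if z: "z \<notin> K" "dist z z' \<le> R" for z z'
    proof -
      have far: "real n + 2 + R < dist z (y n)" if "n < N" for n
        using z(1) that by (force simp: K_def dist_commute)
      have "widening_bump y n z = 0" "widening_bump y n z' = 0" if "n < N" for n
        using far[OF that] R z(2) dist_triangle[of z "y n" z'] by (auto intro!: widening_bump_eq_0)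
      then have "dist (g z) (g z') \<le> dist z z' / (real N + 1)"
        using lip[of N z z'] lip[of N z' z] by (simp add: dist_real_def dist_commute)
      also have "\<dots> \<le> R / (real N + 1)" using z(2) by (simp add: divide_right_mono)
      finally show ?thesis using N by simp
    qed
    moreover have "bounded K" unfolding K_def by auto
    ultimately show "\<exists>K. bounded K \<and> (\<forall>x y. x \<notin> K \<longrightarrow> dist x y \<le> R \<longrightarrow> dist (g x) (g y) < \<epsilon>)"
      by blast
  qed
  moreover have "bounded (range g)"
    using g0 g1 by (auto intro!: boundedI[of _ 1])
  ultimately show ?thesis by (simp add: SO_bounded_def g_def)
qed

lemma SUP_widening_bump_eq_1:
  assumes "dist z (y n) < 1" shows "(SUP n. widening_bump y n z) = 1"
proof (rule antisym)
  have "bdd_above (range (\<lambda>n. widening_bump y n z))"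
    using widening_bump_le_1 by (auto intro!: bdd_aboveI)
  then have "widening_bump y n z \<le> (SUP n. widening_bump y n z)"
    by (rule cSUP_upper[rotated]) simp
  then show "1 \<le> (SUP n. widening_bump y n z)"
    using assms by (simp add: widening_bump_def)
qed (auto intro!: cSUP_least simp: widening_bump_le_1)

lemma SUP_widening_bump_eq_0:
  assumes "\<And>n. dist z (y n) \<ge> real n + 2" shows "(SUP n. widening_bump y n z) = 0"
  using assms by (simp add: widening_bump_eq_0)

section \<open>Lattices of slowly oscillating functions\<close>

text \<open>
  The common features of \<open>SO\<close> and \<open>SO_bounded\<close> on which the reconstruction of the space depends.
\<close>

definition osc_lattice :: "('a::metric_space \<Rightarrow> real) set \<Rightarrow> bool" where
  "osc_lattice L \<longleftrightarrow> SO_bounded \<subseteq> L \<and> L \<subseteq> SO \<and>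
     (\<forall>f\<in>L. \<forall>g\<in>L. inf f g \<in> L \<and> (\<lambda>x. f x + g x) \<in> L) \<and> (\<forall>f\<in>L. \<forall>c. (\<lambda>x. c * f x) \<in> L)"

lemma const_SO_bounded: "(\<lambda>x. c) \<in> SO_bounded"
proof -
  have "diameter ((\<lambda>x::'a. c) ` cball x R) < \<epsilon>" if "\<epsilon> > 0" for x R \<epsilon>
  proof -
    have "(\<lambda>x::'a. c) ` cball x R \<subseteq> {c}" by auto
    then have "diameter ((\<lambda>x::'a. c) ` cball x R) \<le> diameter {c}"
      by (intro diameter_subset) auto
    then show ?thesis using that by simp
  qed
  then show ?thesis
    by (auto simp: SO_bounded_def SO_def slowly_oscillating_def image_constant_conv intro!: exI[of _ "{}"])
qed

text \<open>
  The stability properties of \<open>SO\<close> all have this form: the oscillation of \<open>h\<close> is controlled by those of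
  \<open>f\<close> and \<open>g\<close>.
\<close>

lemma SO_combine:
  fixes f g h :: "'a::metric_space \<Rightarrow> real"
  assumes "proper_space TYPE('a)" "f \<in> SO" "g \<in> SO" "continuous_on UNIV h"
    and C: "\<And>x y. dist (h x) (h y) \<le> C * (dist (f x) (f y) + dist (g x) (g y))"
  shows "h \<in> SO"
proof (rule SO_I[OF assms(1,4)])
  fix R \<epsilon> :: real assume R: "R > 0" and e: "\<epsilon> > 0"
  define \<delta> where "\<delta> = \<epsilon> / (2 * (\<bar>C\<bar> + 1))"
  have d: "\<delta> > 0" using e by (simp add: \<delta>_def)
  obtain K where K: "bounded K" "\<And>x y. x \<notin> K \<Longrightarrow> dist x y \<le> R \<Longrightarrow> dist (f x) (f y) < \<delta>"
    using SO_D[OF assms(1,2) R d] by blast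
  obtain K' where K': "bounded K'" "\<And>x y. x \<notin> K' \<Longrightarrow> dist x y \<le> R \<Longrightarrow> dist (g x) (g y) < \<delta>"
    using SO_D[OF assms(1,3) R d] by blast
  have "dist (h x) (h y) < \<epsilon>" if "x \<notin> K \<union> K'" "dist x y \<le> R" for x y
  proof -
    have "dist (h x) (h y) \<le> (\<bar>C\<bar> + 1) * (dist (f x) (f y) + dist (g x) (g y))"
      by (rule order_trans[OF C mult_right_mono]) auto
    also have "\<dots> < (\<bar>C\<bar> + 1) * (\<delta> + \<delta>)"
      using K(2)[of x y] K'(2)[of x y] that by (intro mult_strict_left_mono add_strict_mono) auto
    also have "\<dots> = \<epsilon>"
    proof -
      have "a * (\<epsilon> / (2 * a) + \<epsilon> / (2 * a)) = \<epsilon>" if "a \<noteq> 0" for a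
        using that by (simp add: field_simps)
      then show ?thesis unfolding \<delta>_def by (smt (verit) abs_ge_zero)
    qed
    finally show ?thesis .
  qed
  then show "\<exists>K. bounded K \<and> (\<forall>x y. x \<notin> K \<longrightarrow> dist x y \<le> R \<longrightarrow> dist (h x) (h y) < \<epsilon>)"
    using K(1) K'(1) by (intro exI[of _ "K \<union> K'"]) auto
qed

lemma osc_lattice_SO:
  assumes "proper_space TYPE('a::metric_space)"
  shows "osc_lattice (SO :: ('a \<Rightarrow> real) set)"
  unfolding osc_lattice_def
proof (intro conjI ballI allI)
  show "SO_bounded \<subseteq> (SO :: ('a \<Rightarrow> real) set)" by (auto simp: SO_bounded_def)
  fix f g :: "'a \<Rightarrow> real" and c assume f: "f \<in> SO" and g: "g \<in> SO"
  note [continuous_intros] = SO_continuous[OF f] SO_continuous[OF g]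
  show "inf f g \<in> SO"
    by (rule SO_combine[OF assms f g, of _ 1])
       (auto simp: inf_fun_def inf_min dist_real_def min_def intro!: continuous_intros continuous_on_min[unfolded min_def])
  show "(\<lambda>x. f x + g x) \<in> SO"
    by (rule SO_combine[OF assms f g, of _ 1]) (auto simp: dist_real_def intro!: continuous_intros)
  have "dist (c * f x) (c * f y) \<le> \<bar>c\<bar> * (dist (f x) (f y) + dist (f x) (f y))" for x y
    by (simp add: dist_real_def abs_mult flip: right_diff_distrib)
  then show "(\<lambda>x. c * f x) \<in> SO"
    by (intro SO_combine[OF assms f f, of _ "\<bar>c\<bar>"]) (auto intro!: continuous_intros)
qed simp

lemma osc_lattice_SO_bounded:
  assumes "proper_space TYPE('a::metric_space)"
  shows "osc_lattice (SO_bounded :: ('a \<Rightarrow> real) set)"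
proof -
  have "bounded (range (inf f g))" if "bounded (range f)" "bounded (range g)" for f g :: "'a \<Rightarrow> real"
  proof -
    have "range (inf f g) \<subseteq> range f \<union> range g" by (auto simp: inf_min min_def)
    then show ?thesis using that by (meson bounded_Un bounded_subset)
  qed
  moreover have "bounded (range (\<lambda>x. f x + g x))" if "bounded (range f)" "bounded (range g)" for f g :: "'a \<Rightarrow> real"
    using bounded_plus_comp[OF that] .
  moreover have "bounded (range (\<lambda>x. c * f x))" if "bounded (range f)" for f :: "'a \<Rightarrow> real" and c
    using bounded_scaleR_comp[OF that, of c] by simp
  ultimately show ?thesis
    using osc_lattice_SO[OF assms] unfolding osc_lattice_def SO_bounded_def by auto
qed



section \<open>Sequences escaping to infinity\<close>

text \<open>
  Selects indices one at a time, where the requirement on the \<open>n\<close>-th index may refer to \<open>n\<close> itself and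
  to the set of all earlier choices.
\<close>

lemma sparse_subsequence:
  assumes "\<And>n A. finite A \<Longrightarrow> \<forall>\<^sub>F j in sequentially. Q n A j"
  obtains r :: "nat \<Rightarrow> nat" where "strict_mono r" "\<And>n. Q n (r ` {..<n}) (r n)"
proof -
  have "\<exists>r. \<forall>n. Q n (r ` {..<n}) (r n) \<and> (\<forall>i<n. r i < r n)"
  proof (rule dependent_wellorder_choice)
    fix j :: nat and f g :: "nat \<Rightarrow> nat" and n
    assume "\<And>i. i < n \<Longrightarrow> f i = g i"
    then have "f ` {..<n} = g ` {..<n}" "\<forall>i<n. f i = g i" by auto
    then show "(Q n (f ` {..<n}) j \<and> (\<forall>i<n. f i < j)) = (Q n (g ` {..<n}) j \<and> (\<forall>i<n. g i < j))"
      by simp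
  next
    fix n and f :: "nat \<Rightarrow> nat"
    have "\<forall>\<^sub>F j in sequentially. \<forall>i\<in>f ` {..<n}. i < j"
      by (rule eventually_ball_finite) (simp_all add: eventually_gt_at_top)
    then have "\<forall>\<^sub>F j in sequentially. Q n (f ` {..<n}) j \<and> (\<forall>i\<in>f ` {..<n}. i < j)"
      using assms[of "f ` {..<n}" n] by (intro eventually_conj) simp_all
    then obtain j where "Q n (f ` {..<n}) j \<and> (\<forall>i\<in>f ` {..<n}. i < j)"
      unfolding eventually_sequentially by blast
    then show "\<exists>j. Q n (f ` {..<n}) j \<and> (\<forall>i<n. f i < j)" by auto
  qed
  then show ?thesis using that by (auto simp: strict_mono_def)
qed

definition escapes :: "(nat \<Rightarrow> 'a::metric_space) \<Rightarrow> bool" where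
  "escapes y \<longleftrightarrow> (\<forall>B. bounded B \<longrightarrow> (\<forall>\<^sub>F n in sequentially. y n \<notin> B))"

lemma escapes_dist_gt: "escapes y \<Longrightarrow> \<forall>\<^sub>F n in sequentially. c < dist a (y n)"
  using bounded_cball[of a c] unfolding escapes_def by (auto simp: not_le)

lemma escapes_subseq: "escapes y \<Longrightarrow> strict_mono r \<Longrightarrow> escapes (\<lambda>n. y (r n))"
  unfolding escapes_def using eventually_subseq by blast

section \<open>Order isomorphisms between lattices of slowly oscillating functions\<close>

text \<open>
  What chain-connectedness and unboundedness contribute to the argument.
\<close>

definition has_close_neighbours :: "real \<Rightarrow> 'a::metric_space itself \<Rightarrow> bool" where
  "has_close_neighbours \<rho> _ \<longleftrightarrow> (\<forall>y::'a. \<exists>y'. y' \<noteq> y \<and> dist y y' \<le> \<rho>)"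

locale so_lattice_iso =
  fixes L :: "('a::metric_space \<Rightarrow> real) set" and M :: "('b::metric_space \<Rightarrow> real) set"
    and T :: "('a \<Rightarrow> real) \<Rightarrow> 'b \<Rightarrow> real" and S :: "('b \<Rightarrow> real) \<Rightarrow> 'a \<Rightarrow> real"
  assumes proper_X: "proper_space TYPE('a)" and proper_Y: "proper_space TYPE('b)"
    and neighbours_X: "\<exists>\<rho>. has_close_neighbours \<rho> TYPE('a)"
    and neighbours_Y: "\<exists>\<rho>. has_close_neighbours \<rho> TYPE('b)"
    and L: "osc_lattice L" and M: "osc_lattice M"
    and T_in: "f \<in> L \<Longrightarrow> T f \<in> M" and S_in: "g \<in> M \<Longrightarrow> S g \<in> L"
    and ST: "f \<in> L \<Longrightarrow> S (T f) = f" and TS: "g \<in> M \<Longrightarrow> T (S g) = g"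
    and T_inf: "f \<in> L \<Longrightarrow> f' \<in> L \<Longrightarrow> T (inf f f') = inf (T f) (T f')"
    and T_0: "T (\<lambda>_. 0) = (\<lambda>_. 0)"
begin

lemma const_L: "(\<lambda>_. c) \<in> L" and inf_L: "f \<in> L \<Longrightarrow> f' \<in> L \<Longrightarrow> inf f f' \<in> L"
  and bounded_L: "f \<in> SO_bounded \<Longrightarrow> f \<in> L"
  and SO_L: "f \<in> L \<Longrightarrow> f \<in> SO" and continuous_L: "f \<in> L \<Longrightarrow> continuous_on UNIV f"
  using L const_SO_bounded by (auto simp: osc_lattice_def intro: SO_continuous)

lemma const_M: "(\<lambda>_. c) \<in> M" and inf_M: "f \<in> M \<Longrightarrow> f' \<in> M \<Longrightarrow> inf f f' \<in> M"
  and scale_M: "f \<in> M \<Longrightarrow> (\<lambda>x. c * f x) \<in> M" and bounded_M: "f \<in> SO_bounded \<Longrightarrow> f \<in> M"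
  and SO_M: "f \<in> M \<Longrightarrow> f \<in> SO" and continuous_M: "f \<in> M \<Longrightarrow> continuous_on UNIV f"
  using M const_SO_bounded by (auto simp: osc_lattice_def intro: SO_continuous)

lemma S_0: "S (\<lambda>_. 0) = (\<lambda>_. 0)"
  using ST[OF const_L[of 0]] T_0 by simp

lemma S_inf: "g \<in> M \<Longrightarrow> g' \<in> M \<Longrightarrow> S (inf g g') = inf (S g) (S g')"
  using T_inf[of "S g" "S g'"] ST[OF inf_L[of "S g" "S g'"]] by (simp add: S_in TS)

text \<open>
  The setting is symmetric, so every result about \<open>T\<close> is also available for \<open>S\<close>.
\<close>

lemma inverse_iso: "so_lattice_iso M L S T"
  by unfold_locales
     (fact proper_X proper_Y neighbours_X neighbours_Y L M T_in S_in ST TS S_inf S_0)+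

lemma T_mono: "f \<in> L \<Longrightarrow> f' \<in> L \<Longrightarrow> f \<le> f' \<Longrightarrow> T f \<le> T f'"
  using T_inf[of f f'] by (simp add: inf.absorb1 le_iff_inf)

lemma S_mono: "g \<in> M \<Longrightarrow> g' \<in> M \<Longrightarrow> g \<le> g' \<Longrightarrow> S g \<le> S g'"
  using S_inf[of g g'] by (simp add: inf.absorb1 le_iff_inf)

definition Lp where "Lp = {f \<in> L. \<forall>x. 0 \<le> f x}"
definition Mp where "Mp = {g \<in> M. \<forall>y. 0 \<le> g y}"

lemma T_Lp: "f \<in> Lp \<Longrightarrow> T f \<in> Mp"
  using T_mono[of "\<lambda>_. 0" f] by (auto simp: Lp_def Mp_def T_in T_0 const_L le_fun_def)

lemma S_Mp: "g \<in> Mp \<Longrightarrow> S g \<in> Lp"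
  using S_mono[of "\<lambda>_. 0" g] by (auto simp: Lp_def Mp_def S_in S_0 const_M le_fun_def)

lemma inf_Lp: "f \<in> Lp \<Longrightarrow> f' \<in> Lp \<Longrightarrow> inf f f' \<in> Lp"
  by (auto simp: Lp_def inf_L)

lemma inf_Mp: "f \<in> Mp \<Longrightarrow> f' \<in> Mp \<Longrightarrow> inf f f' \<in> Mp"
  by (auto simp: Mp_def inf_M)

lemma tent_Lp: "\<delta> > 0 \<Longrightarrow> tent a \<delta> \<in> Lp"
  by (simp add: Lp_def tent_nonneg bounded_L tent_SO_bounded proper_X)

lemma tent_Mp: "\<delta> > 0 \<Longrightarrow> tent a \<delta> \<in> Mp"
  by (simp add: Mp_def tent_nonneg bounded_M tent_SO_bounded proper_Y)

lemma TS_Lp: "f \<in> Lp \<Longrightarrow> S (T f) = f" by (simp add: Lp_def ST)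
lemma TS_Mp: "g \<in> Mp \<Longrightarrow> T (S g) = g" by (simp add: Mp_def TS)

text \<open>
  Two positivity sets intersect exactly if the minimum of the functions is nonzero, which \<open>T\<close> detects.
\<close>

lemma T_meets:
  assumes "f \<in> Lp" "f' \<in> Lp" "0 < f x" "0 < f' x"
  shows "\<exists>y. 0 < T f y \<and> 0 < T f' y"
proof (rule ccontr)
  assume no: "\<nexists>y. 0 < T f y \<and> 0 < T f' y"
  have LL: "f \<in> L" "f' \<in> L" using assms by (auto simp: Lp_def)
  have "inf (T f) (T f') = (\<lambda>_. 0)"
  proof
    fix y
    have "0 \<le> T f y" "0 \<le> T f' y" "\<not> (0 < T f y \<and> 0 < T f' y)"
      using no T_Lp[OF assms(1)] T_Lp[OF assms(2)] by (auto simp: Mp_def)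
    then show "inf (T f) (T f') y = 0" by (simp add: inf_min min_def) linarith
  qed
  then have "T (inf f f') = T (\<lambda>_. 0)" using T_inf[OF LL] T_0 by simp
  then have "inf f f' = (\<lambda>_. 0)" by (metis ST inf_L const_L LL)
  then have "inf (f x) (f' x) = 0" by (metis inf_apply)
  then show False using assms(3,4) by (auto simp: inf_min min_def split: if_splits)
qed

lemma S_meets:
  assumes "g \<in> Mp" "g' \<in> Mp" "0 < g y" "0 < g' y"
  shows "\<exists>x. 0 < S g x \<and> 0 < S g' x"
proof -
  interpret inv: so_lattice_iso M L S T by (rule inverse_iso)
  show ?thesis by (rule inv.T_meets) (use assms in \<open>auto simp: inv.Lp_def Mp_def\<close>)
qed

lemma T_pos:
  assumes "f \<in> Lp" "0 < f x" shows "\<exists>y. 0 < T f y"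
  using T_meets[OF assms(1) assms(1) assms(2) assms(2)] by auto

lemma open_pos_L: "f \<in> L \<Longrightarrow> open {x. 0 < f x}"
  by (rule open_Collect_less) (auto intro: continuous_L)

text \<open>
  Replacing \<open>v\<close> by \<open>v' = S (c * T v)\<close> does not change which positivity sets it meets, while \<open>T v'\<close> can be
  made as large as desired at the given point \<open>y\<close>. The inequality \<open>f \<le> g\<close> persists on \<open>{0 < v'}\<close>,
  whence \<open>inf f v' \<le> g\<close>; applying \<open>T\<close> gives \<open>inf (T f) (T v') \<le> T g\<close>, and at \<open>y\<close> the minimum is \<open>T f y\<close>.
\<close>

lemma T_local:
  assumes "v \<in> Lp" "f \<in> Lp" "g \<in> Lp" and le: "\<And>x. 0 < v x \<Longrightarrow> f x \<le> g x" and y: "0 < T v y"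
  shows "T f y \<le> T g y"
proof -
  note in_L = assms(1-3)[unfolded Lp_def, THEN CollectD, THEN conjunct1]
  define c where "c = (T f y + 1) / T v y"
  have "0 \<le> T f y" using T_Lp[OF assms(2)] by (simp add: Mp_def)
  then have c: "c > 0" "c * T v y = T f y + 1" using y by (auto simp: c_def)
  define v' where "v' = S (\<lambda>z. c * T v z)"
  have M': "(\<lambda>z. c * T v z) \<in> Mp"
    using T_Lp[OF assms(1)] c(1) by (auto simp: Mp_def scale_M)
  then have v': "v' \<in> Lp" "T v' = (\<lambda>z. c * T v z)"
    by (auto simp: v'_def S_Mp TS_Mp)
  have "f x \<le> g x" if v'x: "0 < v' x" for x
  proof (rule ccontr)
    assume "\<not> f x \<le> g x"
    then have x: "x \<in> {x. 0 < v' x} \<inter> {x. g x < f x}" using that by simp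
    have "open ({x. 0 < v' x} \<inter> {x. g x < f x})"
      by (intro open_Int open_Collect_less continuous_L in_L const_L)
         (use v'(1) in \<open>simp add: Lp_def\<close>)
    then obtain \<delta> where d: "\<delta> > 0" "ball x \<delta> \<subseteq> {x. 0 < v' x} \<inter> {x. g x < f x}"
      using x by (meson open_contains_ball)
    obtain z where z: "0 < T (tent x \<delta>) z" "0 < T v' z"
      using T_meets[OF tent_Lp[OF d(1)] v'(1), of x x] v'x d(1) tent_pos[OF d(1), of x x] by auto
    then have "0 < T v z" using c(1) by (simp add: v'(2) zero_less_mult_iff)
    then obtain x' where x': "0 < tent x \<delta> x'" "0 < v x'"
      using S_meets[OF T_Lp[OF tent_Lp[OF d(1)]] T_Lp[OF assms(1)] z(1)]
      by (auto simp: TS_Lp assms(1) d(1) tent_Lp)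
    then have "x' \<in> ball x \<delta>" using d(1) by (simp add: tent_pos dist_commute)
    then show False using d(2) le[OF x'(2)] by force
  qed
  then have "inf f v' \<le> g"
  proof (intro le_funI)
    fix x
    show "inf f v' x \<le> g x"
    proof (cases "0 < v' x")
      case True
      with \<open>\<And>x. 0 < v' x \<Longrightarrow> f x \<le> g x\<close> show ?thesis by (simp add: inf_min min.coboundedI1)
    next
      case False
      moreover have "0 \<le> g x" using assms(3) by (simp add: Lp_def)
      ultimately show ?thesis by (simp add: inf_min min.coboundedI2)
    qed
  qed
  then have "T (inf f v') \<le> T g"
    using v'(1) in_L by (intro T_mono inf_L) (auto simp: Lp_def)
  moreover have "T (inf f v') = inf (T f) (T v')"
    using v'(1) in_L by (intro T_inf) (auto simp: Lp_def)
  ultimately have "inf (T f y) (T v' y) \<le> T g y" by (simp add: le_fun_def)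
  then show ?thesis using c(2) by (simp add: v'(2) inf_min min_def split: if_splits)
qed

lemma S_local:
  assumes "w \<in> Mp" "f \<in> Mp" "g \<in> Mp" "\<And>y. 0 < w y \<Longrightarrow> f y \<le> g y" "0 < S w x"
  shows "S f x \<le> S g x"
proof -
  interpret inv: so_lattice_iso M L S T by (rule inverse_iso)
  show ?thesis by (rule inv.T_local[of w]) (use assms in \<open>auto simp: inv.Lp_def Mp_def\<close>)
qed

section \<open>Separated escaping pieces\<close>

text \<open>
  Suppose \<open>S 1\<close> tends to 0 along the sets \<open>{0 < S (w n)}\<close>. Choose \<open>q n\<close> with \<open>0 < w n (q n)\<close> and a
  neighbour \<open>q' n\<close> of it. After passing to a sparse subsequence, bumps inside the sets \<open>{0 < S (a n)}\<close>,
  with \<open>a n \<le> w n\<close> concentrated near \<open>q n\<close>, can have heights \<open>2 / 2 ^ n\<close> and still exceed \<open>S 1\<close>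
  somewhere. Their sum \<open>f\<close> vanishes at infinity, but \<open>T f\<close> is at least 1 near \<open>q n\<close> and 0 at \<open>q' n\<close>.
\<close>

lemma S_one_not_vanishing:
  assumes y: "escapes y"
    and w: "\<And>n. w n \<in> Mp" "\<And>n. \<exists>q. 0 < w n q" "\<And>n z. 0 < w n z \<Longrightarrow> dist z (y n) < 1"
    and van: "\<And>\<epsilon>. \<epsilon> > 0 \<Longrightarrow> \<forall>\<^sub>F n in sequentially. \<forall>x. 0 < S (w n) x \<longrightarrow> S (\<lambda>_. 1) x < \<epsilon>"
  shows False
proof -
  obtain \<rho> where "has_close_neighbours \<rho> TYPE('b)" using neighbours_Y by blast
  then have \<rho>: "\<And>y::'b. \<exists>y'. y' \<noteq> y \<and> dist y y' \<le> \<rho>" by (simp add: has_close_neighbours_def)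
  have \<rho>0: "\<rho> \<ge> 0" using \<rho>[of "y 0"] zero_le_dist[of "y 0"] order_trans by blast
  obtain q where q: "\<And>n. 0 < w n (q n)" using w(2) by metis
  obtain q' where q': "\<And>n. q' n \<noteq> q n" "\<And>n. dist (q n) (q' n) \<le> \<rho>"
    using that[of "\<lambda>n. SOME z. z \<noteq> q n \<and> dist (q n) z \<le> \<rho>"] someI_ex[OF \<rho>] by blast
  define \<epsilon> where "\<epsilon> = (\<lambda>n::nat. (1/2::real) ^ n)"
  have ev: "\<forall>\<^sub>F j in sequentially. (\<forall>x. 0 < S (w j) x \<longrightarrow> S (\<lambda>_. 1) x < \<epsilon> n) \<and>
      (\<forall>i\<in>A. \<rho> + 4 < dist (y i) (y j))" if "finite A" for n A
  proof (rule eventually_conj)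
    show "\<forall>\<^sub>F j in sequentially. \<forall>x. 0 < S (w j) x \<longrightarrow> S (\<lambda>_. 1) x < \<epsilon> n"
      by (rule van) (simp add: \<epsilon>_def)
    show "\<forall>\<^sub>F j in sequentially. \<forall>i\<in>A. \<rho> + 4 < dist (y i) (y j)"
      by (rule eventually_ball_finite[OF that]) (simp add: escapes_dist_gt y)
  qed
  obtain r where r: "strict_mono r" "\<And>n. (\<forall>x. 0 < S (w (r n)) x \<longrightarrow> S (\<lambda>_. 1) x < \<epsilon> n) \<and>
      (\<forall>i\<in>r ` {..<n}. \<rho> + 4 < dist (y i) (y (r n)))"
    by (rule sparse_subsequence[where Q = "\<lambda>n A j. (\<forall>x. 0 < S (w j) x \<longrightarrow> S (\<lambda>_. 1) x < \<epsilon> n) \<and>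
      (\<forall>i\<in>A. \<rho> + 4 < dist (y i) (y j))"])
       (erule ev, erule that, blast)
  have sep: "\<rho> + 4 < dist (y (r m)) (y (r n))" if "m \<noteq> n" for m n
    using that
  proof (induction m n rule: linorder_wlog)
    case (le m n) then show ?case using r(2)[of n] by auto
  qed (simp add: dist_commute)
  \<comment> \<open>Small enough that the balls around \<open>q\<close> and its neighbour \<open>q'\<close> are disjoint.\<close>
  define \<delta> where "\<delta> = (\<lambda>n. min 1 (dist (q (r n)) (q' (r n)) / 2))"
  have \<delta>: "\<delta> n > 0" "\<delta> n \<le> 1" "2 * \<delta> n \<le> dist (q (r n)) (q' (r n))" for n
    using q'(1)[of "r n"] by (auto simp: \<delta>_def)
  define a where "a = (\<lambda>n. inf (w (r n)) (tent (q (r n)) (\<delta> n)))"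
  define b where "b = (\<lambda>n. tent (q' (r n)) (\<delta> n))"
  have a: "a n \<in> Mp" for n unfolding a_def by (intro inf_Mp w tent_Mp \<delta>)
  have b: "b n \<in> Mp" for n unfolding b_def by (intro tent_Mp \<delta>)
  have a_pos: "0 < a n z \<longleftrightarrow> 0 < w (r n) z \<and> dist z (q (r n)) < \<delta> n" for n z
    by (simp add: a_def inf_min tent_pos \<delta>)
  \<comment> \<open>For equal indices by the choice of \<open>\<delta>\<close>, for different ones by sparseness.\<close>
  have ab: "\<not> (0 < a n z \<and> 0 < b m z)" for n m z
  proof
    assume "0 < a n z \<and> 0 < b m z"
    then have z: "0 < w (r n) z" "dist z (q (r n)) < \<delta> n" "dist z (q' (r m)) < \<delta> m"
      by (auto simp: a_pos b_def tent_pos \<delta>)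
    show False
    proof (cases "n = m")
      case True
      then show False using z \<delta>(3)[of n] dist_triangle3[of "q (r n)" "q' (r n)" z] by simp
    next
      case False
      have "dist (y (r n)) (y (r m)) \<le> dist z (y (r n)) + dist z (q' (r m)) + dist (q (r m)) (q' (r m)) + dist (q (r m)) (y (r m))"
        by metric
      also have "\<dots> < 1 + 1 + \<rho> + 1"
        using w(3)[OF z(1)] w(3)[OF q[of "r m"]] q'(2)[of "r m"] z(3) \<delta>(2)[of m] by linarith
      finally show False using sep[OF False] by simp
    qed
  qed
  have Sa: "S (a n) \<in> Lp" and Sb: "S (b n) \<in> Lp" for n by (auto intro: S_Mp a b)
  have "0 < a n (q (r n))" for n using q \<delta>(1) by (simp add: a_pos)
  then have "\<exists>p. 0 < S (a n) p" for n using S_meets[OF a a, of n "q (r n)" n] by blast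
  then obtain p where p: "\<And>n. 0 < S (a n) (p n)" by metis
  have "\<exists>d. 0 < d \<and> (\<forall>x. dist x (p n) < d \<longrightarrow> 0 < S (a n) x)" for n
  proof -
    have "open {x. 0 < S (a n) x}" using Sa by (intro open_pos_L) (simp add: Lp_def)
    then show ?thesis using p[of n] unfolding open_dist by auto
  qed
  then obtain d where d: "\<And>n. 0 < d n" "\<And>n x. dist x (p n) < d n \<Longrightarrow> 0 < S (a n) x" by metis
  \<comment> \<open>The factor 2 makes the tent at least \<open>\<epsilon> n\<close> on the ball of half the radius.\<close>
  define F where "F = (\<lambda>n x. 2 * \<epsilon> n * tent (p n) (d n) x)"
  define f where "f = (\<lambda>x. \<Sum>n. F n x)"
  have \<epsilon>: "0 < \<epsilon> n" for n by (simp add: \<epsilon>_def)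
  have F0: "0 \<le> F n x" for n x by (simp add: F_def tent_nonneg \<epsilon> less_imp_le)
  have F1: "F n x \<le> 2 * \<epsilon> n" for n x
    using \<epsilon>[of n] d(1)[of n] by (simp add: F_def tent_def)
  have F_supp: "0 < S (a n) x" if "F n x \<noteq> 0" for n x
  proof -
    have "0 < tent (p n) (d n) x" using that tent_nonneg[of "p n" "d n" x] by (force simp: F_def less_le)
    then show ?thesis using d by (simp add: tent_pos)
  qed
  have sm: "summable (\<lambda>n. 2 * \<epsilon> n)" by (simp add: \<epsilon>_def summable_geometric)
  have smF: "summable (\<lambda>n. F n x)" for x
    by (rule summable_comparison_test[OF _ sm]) (use F0 F1 in auto)
  have f_ge: "F n x \<le> f x" for n x
    using sum_le_suminf[OF smF, of "{n}"] F0 by (simp add: f_def)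
  have f_SO: "f \<in> SO_bounded"
  proof (rule uniform_limit_bounded_support_SO_bounded[OF proper_X])
    show "uniform_limit UNIV (\<lambda>n x. \<Sum>i<n. F i x) f sequentially"
      unfolding f_def by (rule Weierstrass_m_test[OF _ sm]) (use F0 F1 in auto)
    show "continuous_on UNIV (\<lambda>x. \<Sum>i<n. F i x)" for n
      unfolding F_def by (intro continuous_intros continuous_tent)
    have "{x. (\<Sum>i<n. F i x) \<noteq> 0} \<subseteq> (\<Union>i<n. ball (p i) (d i))" for n
    proof
      fix x assume "x \<in> {x. (\<Sum>i<n. F i x) \<noteq> 0}"
      then obtain i where i: "i < n" "F i x \<noteq> 0"
        by (metis (mono_tags, lifting) lessThan_iff mem_Collect_eq sum.neutral)
      have "0 < tent (p i) (d i) x" using i(2) tent_nonneg[of "p i" "d i" x] by (force simp: F_def less_le)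
      then show "x \<in> (\<Union>i<n. ball (p i) (d i))" using i(1) d(1) by (auto simp: tent_pos dist_commute)
    qed
    then show "bounded {x. (\<Sum>i<n. F i x) \<noteq> 0}" for n by (rule bounded_subset[rotated]) auto
  qed
  then have f_Lp: "f \<in> Lp" using suminf_nonneg[OF smF F0] by (auto simp: Lp_def bounded_L f_def)
  have Tf_0: "T f (q' (r m)) = 0" for m
  proof (rule ccontr)
    assume "T f (q' (r m)) \<noteq> 0"
    then have "0 < T f (q' (r m))" using T_Lp[OF f_Lp] by (force simp: Mp_def less_le)
    moreover have "0 < b m (q' (r m))" by (simp add: b_def tent_pos \<delta>)
    ultimately obtain x where x: "0 < f x" "0 < S (b m) x"
      using S_meets[OF T_Lp[OF f_Lp] b] unfolding TS_Lp[OF f_Lp] by blast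
    have "\<exists>n. F n x \<noteq> 0"
    proof (rule ccontr)
      assume "\<nexists>n. F n x \<noteq> 0"
      then have "f x = 0" by (simp add: f_def)
      then show False using x(1) by simp
    qed
    then obtain n where "F n x \<noteq> 0" by blast
    then obtain z where "0 < a n z" "0 < b m z"
      using T_meets[OF Sa Sb F_supp x(2)] unfolding TS_Mp[OF a] TS_Mp[OF b] by blast
    then show False using ab by blast
  qed
  have Tf_1: "\<exists>z. 0 < a n z \<and> 1 \<le> T f z" for n
  proof -
    define v where "v = inf (S (a n)) (tent (p n) (d n / 2))"
    have v: "v \<in> Lp" unfolding v_def using d(1) by (intro inf_Lp Sa tent_Lp) simp
    have "0 < v (p n)" using p[of n] d(1)[of n] by (simp add: v_def tent_pos inf_min)
    then obtain z where z: "0 < T v z" using T_pos[OF v] by blast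
    have "T v \<le> a n"
      using T_mono[of v "S (a n)"] v Sa[of n] by (auto simp: Lp_def v_def TS_Mp[OF a])
    then have az: "0 < a n z" using z by (meson le_fun_def less_le_trans)
    have "T (S (\<lambda>_. 1)) z \<le> T f z"
    proof (rule T_local[OF v _ f_Lp _ z])
      show "S (\<lambda>_. 1) \<in> Lp" by (rule S_Mp) (simp add: Mp_def const_M)
      fix x assume x: "0 < v x"
      have "0 < S (a n) x" "dist x (p n) < d n / 2"
        using x d(1)[of n] by (auto simp: v_def inf_min tent_pos)
      have "a n \<le> w (r n)" by (simp add: a_def)
      then have "S (a n) x \<le> S (w (r n)) x"
        using S_mono[of "a n" "w (r n)"] a[of n] w(1)[of "r n"] by (auto simp: Mp_def le_fun_def)
      then have "S (\<lambda>_. 1) x < \<epsilon> n" using r(2)[of n] \<open>0 < S (a n) x\<close> by force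
      also have "\<epsilon> n \<le> F n x"
      proof -
        have "1/2 \<le> tent (p n) (d n) x"
          using \<open>dist x (p n) < d n / 2\<close> d(1)[of n] by (simp add: tent_def le_max_iff_disj field_simps)
        then show ?thesis using \<epsilon>[of n] by (simp add: F_def)
      qed
      also have "\<dots> \<le> f x" by (rule f_ge)
      finally show "S (\<lambda>_. 1) x \<le> f x" by simp
    qed
    then show ?thesis using az by (auto simp: TS const_M)
  qed
  have "T f \<in> SO" using f_Lp by (simp add: Lp_def SO_M T_in)
  then obtain K where K: "bounded K" "\<And>x y. x \<notin> K \<Longrightarrow> dist x y \<le> 1 + \<rho> \<Longrightarrow> dist (T f x) (T f y) < 1"
    using SO_D[OF proper_Y, of "T f" "1 + \<rho>" 1] \<rho>0 by auto
  have "escapes (\<lambda>n. y (r n))" by (rule escapes_subseq[OF y r(1)])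
  then have "\<forall>\<^sub>F n in sequentially. y (r n) \<notin> {x. \<exists>y\<in>K. dist x y \<le> 1}"
    using bounded_thickening[OF K(1), of 1] unfolding escapes_def by blast
  then obtain n where n: "y (r n) \<notin> {x. \<exists>y\<in>K. dist x y \<le> 1}"
    by (meson eventually_sequentially le_refl)
  obtain z where z: "0 < a n z" "1 \<le> T f z" using Tf_1 by blast
  have "dist z (y (r n)) < 1" using z(1) a_pos w(3) by blast
  then have "z \<notin> K" using n by (auto simp: dist_commute)
  moreover have "dist z (q' (r n)) \<le> 1 + \<rho>"
  proof -
    have "dist z (q (r n)) < 1" using z(1) a_pos \<delta>(2)[of n] by force
    then show ?thesis using q'(2)[of "r n"] dist_triangle[of z "q' (r n)" "q (r n)"] by linarith
  qed
  ultimately show False using K(2)[of z "q' (r n)"] z(2) Tf_0[of n] by (simp add: dist_real_def)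
qed


text \<open>
  A function \<open>g\<close> that is 1 near the \<open>y n\<close> and 0 near the \<open>y' n\<close> makes \<open>S g\<close> agree with \<open>S 1\<close> on
  \<open>{0 < S (w n)}\<close> and vanish on \<open>{0 < S (w' n)}\<close>. As \<open>S g\<close> takes close values on these two sets, \<open>S 1\<close>
  tends to 0 along the first ones.
\<close>

lemma separated_images_not_close:
  assumes y: "escapes y" "escapes y'" and yy: "\<And>c. \<forall>\<^sub>F n in sequentially. c \<le> dist (y n) (y' n)"
    and w: "\<And>n. w n \<in> Mp" "\<And>n. \<exists>q. 0 < w n q" "\<And>n z. 0 < w n z \<Longrightarrow> dist z (y n) < 1"
    and w': "\<And>n. w' n \<in> Mp" "\<And>n. \<exists>q. 0 < w' n q" "\<And>n z. 0 < w' n z \<Longrightarrow> dist z (y' n) < 1"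
    and close: "\<And>f \<epsilon>. f \<in> L \<Longrightarrow> \<epsilon> > 0 \<Longrightarrow>
      \<forall>\<^sub>F n in sequentially. \<forall>x x'. 0 < S (w n) x \<longrightarrow> 0 < S (w' n) x' \<longrightarrow> dist (f x) (f x') < \<epsilon>"
  shows False
proof -
  define Q where "Q = (\<lambda>n A j. real n + 3 \<le> dist (y j) (y' j) \<and>
    (\<forall>i\<in>A. real n + 3 < dist (y' i) (y j) \<and> real n + 3 < dist (y i) (y' j)))"
  have "\<forall>\<^sub>F j in sequentially. Q n A j" if "finite A" for n A
    unfolding Q_def
  proof (intro eventually_conj yy)
    show "\<forall>\<^sub>F j in sequentially. \<forall>i\<in>A. real n + 3 < dist (y' i) (y j) \<and> real n + 3 < dist (y i) (y' j)"
      by (rule eventually_ball_finite[OF that]) (simp add: escapes_dist_gt y eventually_conj)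
  qed
  then obtain r where r: "strict_mono r" and Qr: "\<And>n. Q n (r ` {..<n}) (r n)"
    using sparse_subsequence[of Q] by blast
  have far: "real n + 3 \<le> dist (y (r n)) (y' (r m))" for n m
  proof (cases n m rule: linorder_cases)
    case less
    then have "r n \<in> r ` {..<m}" by simp
    then have "real m + 3 < dist (y (r n)) (y' (r m))" using Qr[of m] unfolding Q_def by blast
    then show ?thesis using less by simp
  next
    case greater
    then have "r m \<in> r ` {..<n}" by simp
    then have "real n + 3 < dist (y' (r m)) (y (r n))" using Qr[of n] unfolding Q_def by blast
    then show ?thesis by (simp add: dist_commute)
  qed (use Qr[of n] in \<open>auto simp: Q_def\<close>)
  define g where "g = (\<lambda>z. SUP n. widening_bump (\<lambda>n. y (r n)) n z)"
  have g_SO: "g \<in> SO_bounded" unfolding g_def by (rule SUP_widening_bump_SO_bounded[OF proper_Y])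
  have g1: "g z = 1" if "0 < w (r n) z" for n z
    unfolding g_def by (rule SUP_widening_bump_eq_1[where n = n]) (rule w(3)[OF that])
  have g0: "g z = 0" if "0 < w' (r n) z" for n z
    unfolding g_def
  proof (rule SUP_widening_bump_eq_0)
    fix m
    show "real m + 2 \<le> dist z (y (r m))"
      using far[of m n] w'(3)[OF that] dist_triangle[of "y (r m)" "y' (r n)" z] by (simp add: dist_commute)
  qed
  have "0 \<le> g z" for z
  proof -
    have bdd: "bdd_above (range (\<lambda>n. widening_bump (\<lambda>n. y (r n)) n z))"
      using widening_bump_le_1 by (auto intro!: bdd_aboveI)
    show ?thesis unfolding g_def by (rule cSUP_upper2[OF bdd UNIV_I widening_bump_nonneg])
  qed
  then have g: "g \<in> Mp" using g_SO by (simp add: Mp_def bounded_M)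
  have c: "(\<lambda>_. c) \<in> Mp" if "0 \<le> c" for c using that by (simp add: Mp_def const_M)
  have S1: "S (\<lambda>_. 1) x \<le> S g x" if "0 < S (w (r n)) x" for n x
    by (rule S_local[OF w(1)[of "r n"] c g _ that]) (simp_all add: g1)
  have S0: "S g x \<le> 0" if "0 < S (w' (r n)) x" for n x
    using S_local[OF w'(1)[of "r n"] g c[of 0] _ that] by (simp add: g0 S_0)
  show False
  proof (rule S_one_not_vanishing[where y = "\<lambda>n. y (r n)" and w = "\<lambda>n. w (r n)"])
    show "escapes (\<lambda>n. y (r n))" by (rule escapes_subseq[OF y(1) r])
    fix \<epsilon> :: real assume "\<epsilon> > 0"
    have "S g \<in> L" using S_Mp[OF g] by (simp add: Lp_def)
    from eventually_subseq[OF r close[OF this \<open>\<epsilon> > 0\<close>]]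
    show "\<forall>\<^sub>F n in sequentially. \<forall>x. 0 < S (w (r n)) x \<longrightarrow> S (\<lambda>_. 1) x < \<epsilon>"
    proof (rule eventually_mono, intro allI impI)
      fix n x
      assume n: "\<forall>x x'. 0 < S (w (r n)) x \<longrightarrow> 0 < S (w' (r n)) x' \<longrightarrow> dist (S g x) (S g x') < \<epsilon>"
        and x: "0 < S (w (r n)) x"
      obtain q where "0 < w' (r n) q" using w'(2) by blast
      then obtain x' where x': "0 < S (w' (r n)) x'" using S_meets[OF w'(1) w'(1)] by blast
      have "dist (S g x) (S g x') < \<epsilon>" using n x x' by blast
      then show "S (\<lambda>_. 1) x < \<epsilon>" using S1[OF x] S0[OF x'] by (simp add: dist_real_def)
    qed
  qed (use w in auto)
qed

section \<open>The point correspondence\<close>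

text \<open>
  If the images of all tents shrinking to \<open>x\<close> had unbounded positivity sets, one could pick pieces of
  them escaping to infinity with mutual distances tending to infinity. Their counterparts in \<open>X\<close>
  converge to \<open>x\<close>, where every function is continuous: this contradicts
  \<open>separated_images_not_close\<close>.
\<close>

lemma bounded_image_support:
  "\<exists>v\<in>Lp. 0 < v x \<and> bounded {z. 0 < T v z}"
proof (rule ccontr)
  assume "\<not> ?thesis"
  then have unb: "\<not> bounded {z. 0 < T v z}" if "v \<in> Lp" "0 < v x" for v using that by blast
  \<comment> \<open>The points \<open>y\<close> and \<open>y'\<close> below come from the same images, the second ones chosen far from the first.\<close>
  define v where "v = (\<lambda>n::nat. tent x (1 / (real n + 1)))"
  have v: "v n \<in> Lp" "0 < v n x" for n by (auto simp: v_def tent_pos intro!: tent_Lp)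
  have far: "\<exists>z. 0 < T (v n) z \<and> c < dist o' z" for n c o'
  proof (rule ccontr)
    assume "\<not> ?thesis"
    then have "{z. 0 < T (v n) z} \<subseteq> cball o' c" by (force simp: not_less)
    then show False using unb[OF v] bounded_cball bounded_subset by blast
  qed
  fix o' :: 'b
  have "\<exists>y. \<forall>n. 0 < T (v n) (y n) \<and> c n < dist o' (y n)" for c :: "nat \<Rightarrow> real"
    by (rule choice) (use far in blast)
  then obtain P where P: "\<And>c n. 0 < T (v n) (P c n)" "\<And>c n. c n < dist o' (P c n)" by metis
  define y where "y = P real"
  define y' where "y' = P (\<lambda>n. real n + dist o' (y n))"
  have y: "\<And>n. 0 < T (v n) (y n)" "\<And>n. real n < dist o' (y n)"
    and y': "\<And>n. 0 < T (v n) (y' n)" "\<And>n. real n + dist o' (y n) < dist o' (y' n)"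
    unfolding y_def y'_def by (rule P)+
  have esc: "escapes z" if z: "\<And>n. real n < dist o' (z n)" for z :: "nat \<Rightarrow> 'b"
    unfolding escapes_def
  proof (intro allI impI)
    fix B :: "'b set" assume "bounded B"
    then obtain e where "\<And>b. b \<in> B \<Longrightarrow> dist o' b \<le> e" unfolding bounded_any_center[of B o'] by blast
    moreover obtain N :: nat where "e \<le> real N" using real_arch_simple by blast
    ultimately have "z n \<notin> B" if "n \<ge> N" for n using z[of n] that by force
    then show "\<forall>\<^sub>F n in sequentially. z n \<notin> B" unfolding eventually_sequentially by blast
  qed
  define w where "w = (\<lambda>n. inf (T (v n)) (tent (y n) 1))"
  define w' where "w' = (\<lambda>n. inf (T (v n)) (tent (y' n) 1))"
  have Sw: "x' \<in> ball x (1 / (real n + 1))" if "0 < S (inf (T (v n)) (tent z 1)) x'" for z n x'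
  proof -
    have "S (inf (T (v n)) (tent z 1)) \<le> S (T (v n))"
      using T_Lp[OF v(1)] tent_Mp[of 1 z] by (intro S_mono inf_M) (auto simp: Mp_def)
    then have "0 < v n x'" using that v(1) by (auto simp: TS_Lp le_fun_def intro: less_le_trans)
    then show ?thesis by (simp add: v_def tent_pos dist_commute)
  qed
  show False
  proof (rule separated_images_not_close[where y = y and y' = y' and w = w and w' = w'])
    show "escapes y" using y(2) by (rule esc)
    show "escapes y'"
    proof (rule esc)
      show "real n < dist o' (y' n)" for n using y'(2)[of n] zero_le_dist[of o' "y n"] by linarith
    qed
    fix c :: real
    obtain N :: nat where N: "c \<le> real N" using real_arch_simple by blast
    have "c \<le> dist (y n) (y' n)" if "N \<le> n" for n
      using N that y'(2)[of n] dist_triangle[of o' "y' n" "y n"] by simp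
    then show "\<forall>\<^sub>F n in sequentially. c \<le> dist (y n) (y' n)" unfolding eventually_sequentially by blast
  next
    fix n
    show "w n \<in> Mp" "w' n \<in> Mp" by (auto simp: w_def w'_def intro!: inf_Mp T_Lp v tent_Mp)
    show "\<exists>q. 0 < w n q" using y(1)[of n] by (auto simp: w_def inf_min tent_pos intro!: exI[of _ "y n"])
    show "\<exists>q. 0 < w' n q" using y'(1)[of n] by (auto simp: w'_def inf_min tent_pos intro!: exI[of _ "y' n"])
    show "dist z (y n) < 1" if "0 < w n z" for z using that by (simp add: w_def inf_min tent_pos)
    show "dist z (y' n) < 1" if "0 < w' n z" for z using that by (simp add: w'_def inf_min tent_pos)
  next
    fix f and \<epsilon> :: real assume f: "f \<in> L" and e: "\<epsilon> > 0"
    then obtain d where d: "d > 0" "\<And>x'. dist x' x < d \<Longrightarrow> dist (f x') (f x) < \<epsilon>/2"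
      using continuous_L[OF f] unfolding continuous_on_iff by (metis UNIV_I half_gt_zero)
    obtain N :: nat where N: "inverse (real (Suc N)) < d" using reals_Archimedean[OF d(1)] by blast
    have "dist (f p) (f p') < \<epsilon>" if "N \<le> n" "0 < S (w n) p" "0 < S (w' n) p'" for n p p'
    proof -
      have "1 / (real n + 1) \<le> 1 / (real N + 1)" using that(1) by (intro divide_left_mono) auto
      moreover have "1 / (real N + 1) < d" using N by (simp add: inverse_eq_divide add.commute)
      ultimately have "1 / (real n + 1) < d" by linarith
      then have "dist p x < d" "dist p' x < d"
        using Sw[of n "y n" p] Sw[of n "y' n" p'] that by (auto simp: w_def w'_def dist_commute)
      then show ?thesis using d(2)[of p] d(2)[of p'] dist_triangle2[of "f p" "f p'" "f x"] by linarith
    qed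
    then show "\<forall>\<^sub>F n in sequentially. \<forall>x x'. 0 < S (w n) x \<longrightarrow> 0 < S (w' n) x' \<longrightarrow> dist (f x) (f x') < \<epsilon>"
      unfolding eventually_sequentially by blast
  qed
qed

text \<open>
  Says that \<open>y\<close> lies in the closure of \<open>{z. 0 < T v z}\<close> whenever \<open>0 < v x\<close>; testing the closure with
  functions \<open>w\<close> makes the definition symmetric in \<open>x\<close> and \<open>y\<close>.
\<close>

definition corresponds :: "'a \<Rightarrow> 'b \<Rightarrow> bool" where
  "corresponds x y \<longleftrightarrow> (\<forall>v\<in>Lp. \<forall>w\<in>Mp. 0 < v x \<longrightarrow> 0 < w y \<longrightarrow> (\<exists>z. 0 < T v z \<and> 0 < w z))"

lemma corresponds_meets:
  assumes "corresponds x y" "open U" "x \<in> U" "w \<in> Mp" "0 < w y"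
  shows "\<exists>p\<in>U. 0 < S w p"
proof -
  obtain \<delta> where d: "\<delta> > 0" "ball x \<delta> \<subseteq> U" using assms(2,3) open_contains_ball by blast
  have t: "tent x \<delta> \<in> Lp" "0 < tent x \<delta> x" using d(1) by (auto simp: tent_Lp tent_pos)
  obtain z where "0 < T (tent x \<delta>) z" "0 < w z"
    using assms(1,4,5) t unfolding corresponds_def by blast
  then obtain p where "0 < tent x \<delta> p" "0 < S w p"
    using S_meets[OF T_Lp[OF t(1)] assms(4)] unfolding TS_Lp[OF t(1)] by blast
  then have "p \<in> ball x \<delta>" using d(1) by (simp add: tent_pos dist_commute)
  then show ?thesis using d(2) \<open>0 < S w p\<close> by blast
qed

lemma corresponds_inverse:
  "so_lattice_iso.corresponds M L S y x \<longleftrightarrow> corresponds x y"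
proof -
  interpret inv: so_lattice_iso M L S T by (rule inverse_iso)
  have "inv.Lp = Mp" "inv.Mp = Lp" by (auto simp: inv.Lp_def inv.Mp_def Mp_def Lp_def)
  moreover have "(\<exists>z. 0 < S w z \<and> 0 < v z) \<longleftrightarrow> (\<exists>z. 0 < T v z \<and> 0 < w z)" if "v \<in> Lp" "w \<in> Mp" for v w
    using S_meets[OF T_Lp[OF that(1)] that(2)] T_meets[OF that(1) S_Mp[OF that(2)]]
    unfolding TS_Lp[OF that(1)] TS_Mp[OF that(2)] by blast
  ultimately show ?thesis
    unfolding inv.corresponds_def corresponds_def by blast
qed

text \<open>
  Near \<open>y\<close> a suitable \<open>g\<close> dominates \<open>T 1\<close>, and near \<open>y'\<close> it vanishes. So \<open>S g\<close> has values at least 1 and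
  values at most 0 arbitrarily close to \<open>x\<close>.
\<close>

lemma corresponds_unique:
  assumes "corresponds x y" "corresponds x y'" shows "y = y'"
proof (rule ccontr)
  assume "y \<noteq> y'"
  define d where "d = dist y y' / 2"
  have d: "d > 0" using \<open>y \<noteq> y'\<close> by (simp add: d_def)
  define h where "h = T (\<lambda>_. 1)"
  have one: "(\<lambda>_. 1) \<in> Lp" by (simp add: Lp_def const_L)
  have h: "h \<in> Mp" unfolding h_def by (rule T_Lp[OF one])
  have "bounded (h ` cball y 1)"
    using h by (intro proper_bounded_image[OF proper_Y continuous_M]) (auto simp: Mp_def)
  then obtain c where c_pos: "c > 0" and "\<forall>a\<in>h ` cball y 1. norm a \<le> c"
    unfolding bounded_pos by blast
  then have "h z \<le> c" if "dist z y \<le> 1" for z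
    using that by (force simp: dist_commute)
  note c = this c_pos
  \<comment> \<open>The tent is at least 1/2 near \<open>y\<close>, so there the factor \<open>2 * c\<close> lifts it above \<open>T 1\<close>.\<close>
  define g where "g = inf h (\<lambda>z. 2 * c * tent y d z)"
  \<comment> \<open>Within distance 1 the bound \<open>c\<close> is valid, within \<open>d/2\<close> the tent is at least 1/2.\<close>
  define e where "e = min 1 (d/2)"
  have e: "e > 0" using d by (simp add: e_def)
  have g: "g \<in> Mp"
    unfolding g_def using tent_Mp[OF d, of y] c(2) by (intro inf_Mp h) (auto simp: Mp_def scale_M)
  have near: "h z \<le> g z" if "0 < tent y e z" for z
  proof -
    have z: "dist z y < 1" "dist z y < d/2" using that e by (auto simp: tent_pos e_def)
    have "1/2 \<le> tent y d z" using z(2) d by (simp add: tent_def le_max_iff_disj field_simps)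
    then have "c \<le> 2 * c * tent y d z" using c(2) by simp
    then show ?thesis using c(1)[of z] z(1) by (simp add: g_def inf_min)
  qed
  have far: "g z \<le> 0" if "0 < tent y' d z" for z
  proof -
    have "dist z y' < d" using that d by (simp add: tent_pos)
    then have "\<not> dist z y < d" using dist_triangle3[of y y' z] by (auto simp: d_def field_simps)
    then have "\<not> 0 < tent y d z" using d by (simp add: tent_pos)
    then have "tent y d z = 0" using tent_nonneg[of y d z] by linarith
    then show ?thesis by (simp add: g_def inf_min)
  qed
  have Sg: "1 \<le> S g p" if "0 < S (tent y e) p" for p
    using S_local[OF tent_Mp[OF e] h g near that] by (simp add: h_def TS_Lp[OF one])
  have zero: "(\<lambda>_. 0) \<in> Mp" by (simp add: Mp_def const_M)
  have Sg': "S g p \<le> 0" if "0 < S (tent y' d) p" for p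
    using S_local[OF tent_Mp[OF d] g zero far that] by (simp add: S_0)
  have cont: "continuous_on UNIV (S g)" using S_Mp[OF g] by (auto simp: Lp_def continuous_L)
  show False
  proof (cases "S g x < 1")
    case True
    obtain p where "p \<in> {p. S g p < 1}" "0 < S (tent y e) p"
      using corresponds_meets[OF assms(1), of "{p. S g p < 1}" "tent y e"] True e
        open_Collect_less[OF cont, of "\<lambda>_. 1"] by (auto simp: tent_Mp tent_pos)
    then show False using Sg[of p] by simp
  next
    case False
    then have "0 < S g x" by simp
    then obtain p where "p \<in> {p. 0 < S g p}" "0 < S (tent y' d) p"
      using corresponds_meets[OF assms(2), of "{p. 0 < S g p}" "tent y' d"] d
        open_Collect_less[OF _ cont, of "\<lambda>_. 0"] by (auto simp: tent_Mp tent_pos)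
    then show False using Sg'[of p] by simp
  qed
qed

lemma finite_lower_bound:
  assumes "finite F" "F \<subseteq> Lp" "\<And>v. v \<in> F \<Longrightarrow> 0 < v x"
  shows "\<exists>u\<in>Lp. 0 < u x \<and> (\<forall>v\<in>F. u \<le> v)"
  using assms
proof (induction F)
  case empty
  show ?case by (intro bexI[of _ "\<lambda>_. 1"]) (auto simp: Lp_def const_L)
next
  case (insert v F)
  then obtain u where "u \<in> Lp" "0 < u x" "\<forall>v\<in>F. u \<le> v" by auto
  moreover have "inf u v \<in> Lp" using insert.prems \<open>u \<in> Lp\<close> by (intro inf_Lp) auto
  moreover have "0 < inf u v x" using insert.prems \<open>0 < u x\<close> by (simp add: inf_min)
  moreover have "\<forall>v'\<in>insert v F. inf u v \<le> v'" using \<open>\<forall>v\<in>F. u \<le> v\<close> le_infI1 inf_le2 by blast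
  ultimately show ?case by blast
qed

text \<open>
  A compactness argument, starting from a function whose image has bounded positivity set: the part
  of a large ball outside \<open>W\<close> is covered by finitely many sets \<open>{0 < w}\<close> that are avoided by the images
  of suitable functions positive at \<open>x\<close>, and a common lower bound of these works. With empty \<open>W\<close>
  this shows that some point corresponds to \<open>x\<close>.
\<close>

lemma small_image_support:
  assumes "open W" and W: "\<And>y. corresponds x y \<Longrightarrow> y \<in> W"
  shows "\<exists>v\<in>Lp. 0 < v x \<and> {z. 0 < T v z} \<subseteq> W"
proof -
  obtain v0 where v0: "v0 \<in> Lp" "0 < v0 x" "bounded {z. 0 < T v0 z}" using bounded_image_support by blast
  obtain a e where K: "{z. 0 < T v0 z} \<subseteq> cball a e" using v0(3) bounded_subset_cball by blast
  have "\<exists>v w. v \<in> Lp \<and> w \<in> Mp \<and> 0 < v x \<and> 0 < w y \<and> (\<forall>z. \<not> (0 < T v z \<and> 0 < w z))" if "y \<notin> W" for y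
    using W[of y] that unfolding corresponds_def by blast
  then obtain v w where vw: "\<And>y. y \<notin> W \<Longrightarrow> v y \<in> Lp \<and> w y \<in> Mp \<and> 0 < v y x \<and> 0 < w y y \<and>
      (\<forall>z. \<not> (0 < T (v y) z \<and> 0 < w y z))" by metis
  have comp: "compact (cball a e - W)"
    using proper_Y assms(1) by (auto simp: proper_space_def intro: compact_diff)
  have cover: "cball a e - W \<subseteq> (\<Union>y\<in>cball a e - W. {z. 0 < w y z})" using vw by blast
  have opn: "open {z. 0 < w y z}" if "y \<in> cball a e - W" for y
    using vw[of y] that by (intro open_Collect_less continuous_M const_M) (auto simp: Mp_def)
  obtain F where F: "F \<subseteq> cball a e - W" "finite F" "cball a e - W \<subseteq> (\<Union>y\<in>F. {z. 0 < w y z})"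
    by (rule compactE_image[OF comp opn cover])
  obtain u where u: "u \<in> Lp" "0 < u x" "\<forall>v'\<in>insert v0 (v ` F). u \<le> v'"
    using finite_lower_bound[of "insert v0 (v ` F)" x] F(1,2) v0 vw by blast
  have Tu: "T u z \<le> T v' z" if "v' \<in> insert v0 (v ` F)" "v' \<in> Lp" for v' z
  proof -
    have "T u \<le> T v'" using u that by (intro T_mono) (auto simp: Lp_def)
    then show ?thesis by (simp add: le_fun_def)
  qed
  have "z \<in> W" if z: "0 < T u z" for z
  proof (rule ccontr)
    assume "z \<notin> W"
    have "0 < T v0 z" using Tu[of v0 z] v0(1) z by simp
    then have "z \<in> cball a e - W" using K \<open>z \<notin> W\<close> by auto
    then obtain y where y: "y \<in> F" "0 < w y z" using F(3) by auto
    then have "y \<notin> W" using F(1) by blast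
    have "0 < T (v y) z" using Tu[of "v y" z] y(1) vw[OF \<open>y \<notin> W\<close>] z by simp
    then show False using vw[OF \<open>y \<notin> W\<close>] y(2) by blast
  qed
  then show ?thesis using u by blast
qed

lemma corresponds_ex1: "\<exists>!y. corresponds x y"
proof -
  have "\<exists>y. corresponds x y"
  proof (rule ccontr)
    assume "\<not> ?thesis"
    then obtain v where "v \<in> Lp" "0 < v x" "{z. 0 < T v z} \<subseteq> {}"
      using small_image_support[of "{}" x] by auto
    then show False using T_pos by blast
  qed
  then show ?thesis using corresponds_unique by blast
qed

lemma corresponds_continuous:
  assumes "\<And>x. corresponds x (\<phi> x)"
  shows "continuous_on UNIV \<phi>"
  unfolding continuous_on_iff
proof (intro ballI allI impI)
  fix x and e :: real assume e: "e > 0"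
  have "\<phi> x \<in> ball (\<phi> x) (e/2)" using e by simp
  then obtain v where v: "v \<in> Lp" "0 < v x" "{z. 0 < T v z} \<subseteq> ball (\<phi> x) (e/2)"
    using small_image_support[of "ball (\<phi> x) (e/2)" x] corresponds_unique[OF assms] by (metis open_ball)
  have "open {z. 0 < v z}" using v(1) by (simp add: open_pos_L Lp_def)
  then obtain d where d: "d > 0" "\<And>z. dist z x < d \<Longrightarrow> 0 < v z"
    using v(2) unfolding open_dist by auto
  have "dist (\<phi> z) (\<phi> x) < e" if zx: "dist z x < d" for z
  proof (rule ccontr)
    assume far: "\<not> dist (\<phi> z) (\<phi> x) < e"
    have e2: "e/2 > 0" using e by simp
    have "0 < tent (\<phi> z) (e/2) (\<phi> z)" using e2 by (simp add: tent_pos)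
    then obtain y where "0 < T v y" "0 < tent (\<phi> z) (e/2) y"
      using assms[of z] v(1) tent_Mp[OF e2, of "\<phi> z"] d(2)[OF zx] unfolding corresponds_def by blast
    then have "dist y (\<phi> x) < e/2" "dist y (\<phi> z) < e/2"
      using v(3) e2 by (auto simp: tent_pos dist_commute)
    then show False using far dist_triangle3[of "\<phi> z" "\<phi> x" y] by simp
  qed
  then show "\<exists>d>0. \<forall>z\<in>UNIV. dist z x < d \<longrightarrow> dist (\<phi> z) (\<phi> x) < e" using d(1) by blast
qed

text \<open>
  Otherwise there are \<open>x n\<close>, \<open>x' n\<close> at distance at most \<open>R\<close> whose images drift apart. Both sequences
  escape to infinity, as do their images, since \<open>\<phi>\<close> and \<open>\<psi>\<close> map bounded sets to bounded sets. Functions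
  on \<open>X\<close> oscillate little at the scale \<open>R + 2\<close> that contains the counterparts of small pieces around
  \<open>\<phi> (x n)\<close> and \<open>\<phi> (x' n)\<close>, contrary to \<open>separated_images_not_close\<close>.
\<close>

lemma corresponds_bounded_on_scales:
  assumes \<psi>: "continuous_on UNIV \<psi>" "\<And>x. \<psi> (\<phi> x) = x"
    and inv: "\<And>x y. \<phi> x = y \<longleftrightarrow> corresponds x y"
  shows "\<exists>D. \<forall>x x'. dist x x' \<le> R \<longrightarrow> dist (\<phi> x) (\<phi> x') \<le> D"
proof (rule ccontr)
  assume "\<not> ?thesis"
  then have "\<exists>x x'. dist x x' \<le> R \<and> real n < dist (\<phi> x) (\<phi> x')" for n by (meson not_le)
  then obtain x x' where x: "\<And>n. dist (x n) (x' n) \<le> R" "\<And>n. real n < dist (\<phi> (x n)) (\<phi> (x' n))" by metis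
  interpret inv: so_lattice_iso M L S T by (rule inverse_iso)
  have c\<phi>: "continuous_on UNIV \<phi>"
    by (rule corresponds_continuous) (simp flip: inv)
  have esc: "escapes p" "escapes (\<lambda>n. \<phi> (p n))"
    if p: "\<And>n. dist (p n) (p' n) \<le> R" "\<And>n. real n < dist (\<phi> (p n)) (\<phi> (p' n))" for p p' :: "nat \<Rightarrow> 'a"
  proof -
    show e: "escapes p"
      unfolding escapes_def
    proof (intro allI impI)
      fix B :: "'a set" assume B: "bounded B"
      define B' where "B' = {x. \<exists>y\<in>B. dist x y \<le> R}"
      have "bounded (B \<union> B')" unfolding B'_def using B bounded_thickening[OF B] by simp
      then have "bounded (\<phi> ` (B \<union> B'))" by (rule proper_bounded_image[OF proper_X c\<phi>])
      then obtain D where D: "\<And>x y. x \<in> B \<union> B' \<Longrightarrow> y \<in> B \<union> B' \<Longrightarrow> dist (\<phi> x) (\<phi> y) \<le> D"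
        unfolding bounded_two_points by blast
      obtain N :: nat where N: "D \<le> real N" using real_arch_simple by blast
      have "p n \<notin> B" if "N \<le> n" for n
      proof
        assume "p n \<in> B"
        then have "p' n \<in> B'" using p(1)[of n] by (auto simp: B'_def dist_commute intro!: bexI[of _ "p n"])
        then show False using D[of "p n" "p' n"] \<open>p n \<in> B\<close> p(2)[of n] N that by simp
      qed
      then show "\<forall>\<^sub>F n in sequentially. p n \<notin> B" unfolding eventually_sequentially by blast
    qed
    show "escapes (\<lambda>n. \<phi> (p n))"
      unfolding escapes_def
    proof (intro allI impI)
      fix B :: "'b set" assume "bounded B"
      then have "bounded (\<psi> ` B)" by (rule proper_bounded_image[OF proper_Y \<psi>(1)])
      then have "\<forall>\<^sub>F n in sequentially. p n \<notin> \<psi> ` B" using e by (simp add: escapes_def)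
      then show "\<forall>\<^sub>F n in sequentially. \<phi> (p n) \<notin> B"
        by (rule eventually_mono) (metis \<psi>(2) imageI)
    qed
  qed
  have "\<exists>w. w \<in> Mp \<and> 0 < w (\<phi> p) \<and> (\<forall>z. 0 < w z \<longrightarrow> dist z (\<phi> p) < 1) \<and> (\<forall>z. 0 < S w z \<longrightarrow> dist z p < 1)" for p
  proof -
    have "q \<in> ball p 1" if "inv.corresponds (\<phi> p) q" for q
    proof -
      have "\<phi> q = \<phi> p" using that corresponds_inverse inv by metis
      then have "q = p" using \<psi>(2) by metis
      then show ?thesis by simp
    qed
    then obtain v where v: "v \<in> inv.Lp" "0 < v (\<phi> p)" "{z. 0 < S v z} \<subseteq> ball p 1"
      using inv.small_image_support[of "ball p 1" "\<phi> p"] by blast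
    have vM: "v \<in> Mp" using v(1) by (simp add: inv.Lp_def Mp_def)
    define w where "w = inf v (tent (\<phi> p) 1)"
    have w: "w \<in> Mp" unfolding w_def by (intro inf_Mp vM tent_Mp) simp
    have "S w \<le> S v" using w vM by (intro S_mono) (auto simp: Mp_def w_def)
    then have "dist z p < 1" if "0 < S w z" for z
    proof -
      have "0 < S v z" using that \<open>S w \<le> S v\<close> by (auto simp: le_fun_def intro: less_le_trans)
      then show ?thesis using v(3) by (auto simp: dist_commute)
    qed
    moreover have "dist z (\<phi> p) < 1" if "0 < w z" for z using that by (simp add: w_def inf_min tent_pos)
    moreover have "0 < w (\<phi> p)" using v(2) by (simp add: w_def inf_min tent_pos)
    ultimately show ?thesis using w by blast
  qed
  then obtain W where W: "\<And>p. W p \<in> Mp" "\<And>p. 0 < W p (\<phi> p)" "\<And>p z. 0 < W p z \<Longrightarrow> dist z (\<phi> p) < 1"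
    "\<And>p z. 0 < S (W p) z \<Longrightarrow> dist z p < 1" by metis
  have e: "escapes x" "escapes (\<lambda>n. \<phi> (x n))" "escapes (\<lambda>n. \<phi> (x' n))"
    using esc[of x x'] esc[of x' x] x by (auto simp: dist_commute)
  show False
  proof (rule separated_images_not_close[where y = "\<lambda>n. \<phi> (x n)" and y' = "\<lambda>n. \<phi> (x' n)"
        and w = "\<lambda>n. W (x n)" and w' = "\<lambda>n. W (x' n)"])
    fix c :: real
    obtain N :: nat where N: "c \<le> real N" using real_arch_simple by blast
    have "c \<le> dist (\<phi> (x n)) (\<phi> (x' n))" if "N \<le> n" for n
      using N that x(2)[of n] by simp
    then show "\<forall>\<^sub>F n in sequentially. c \<le> dist (\<phi> (x n)) (\<phi> (x' n))"
      unfolding eventually_sequentially by blast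
  next
    fix f and \<epsilon> :: real assume f: "f \<in> L" and eps: "\<epsilon> > 0"
    have "0 < \<bar>R\<bar> + 2" "0 < \<epsilon>/2" using eps by auto
    then obtain K where K: "bounded K" "\<And>x y. x \<notin> K \<Longrightarrow> dist x y \<le> \<bar>R\<bar> + 2 \<Longrightarrow> dist (f x) (f y) < \<epsilon>/2"
      using SO_D[OF proper_X SO_L[OF f]] by metis
    have "\<forall>\<^sub>F n in sequentially. x n \<notin> K" using e(1) K(1) by (simp add: escapes_def)
    then show "\<forall>\<^sub>F n in sequentially. \<forall>p p'. 0 < S (W (x n)) p \<longrightarrow> 0 < S (W (x' n)) p' \<longrightarrow> dist (f p) (f p') < \<epsilon>"
    proof (rule eventually_mono, intro allI impI)
      fix n p p' assume n: "x n \<notin> K" and p: "0 < S (W (x n)) p" "0 < S (W (x' n)) p'"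
      have "dist (x n) p \<le> \<bar>R\<bar> + 2" using W(4)[OF p(1)] by (simp add: dist_commute)
      moreover have "dist (x n) p' \<le> \<bar>R\<bar> + 2"
        using W(4)[OF p(2)] x(1)[of n] dist_triangle2[of "x n" p' "x' n"] by (simp add: dist_commute)
      ultimately show "dist (f p) (f p') < \<epsilon>"
        using K(2)[OF n, of p] K(2)[OF n, of p'] dist_triangle3[of "f p" "f p'" "f (x n)"] by simp
    qed
  qed (use e W in blast)+
qed

end

lemma uniformly_expansiveI:
  assumes "\<And>R. \<exists>D. \<forall>x x'. dist x x' \<le> R \<longrightarrow> dist (f x) (f x') \<le> D"
  shows "uniformly_expansive f"
proof -
  define A where "A = (\<lambda>t. {dist (f x) (f x') | x x'. dist x x' \<le> t})"
  define \<sigma> where "\<sigma> = (\<lambda>t. Sup (A t))"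
  have bdd: "bdd_above (A t)" for t
  proof -
    obtain D where "\<forall>x x'. dist x x' \<le> t \<longrightarrow> dist (f x) (f x') \<le> D" using assms by blast
    then show ?thesis by (intro bdd_aboveI[of _ D]) (auto simp: A_def)
  qed
  have ne: "0 \<in> A t" if "0 \<le> t" for t
    using that by (auto simp: A_def intro!: exI[of _ undefined])
  have "mono_on {0..} \<sigma>"
  proof (rule mono_onI)
    fix s t :: real assume "s \<in> {0..}" "s \<le> t"
    then show "\<sigma> s \<le> \<sigma> t"
      unfolding \<sigma>_def
    proof (intro cSup_subset_mono bdd)
      show "A s \<noteq> {}" using ne[of s] \<open>s \<in> {0..}\<close> by auto
      show "A s \<subseteq> A t" using \<open>s \<le> t\<close> unfolding A_def by fastforce
    qed
  qed
  moreover have "\<sigma> ` {0..} \<subseteq> {0..}"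
    using cSup_upper[OF ne bdd] by (auto simp: \<sigma>_def)
  moreover have "dist (f x) (f x') \<le> \<sigma> (dist x x')" for x x'
    unfolding \<sigma>_def by (rule cSup_upper[OF _ bdd]) (auto simp: A_def)
  ultimately show ?thesis unfolding uniformly_expansive_def by blast
qed

lemma (in so_lattice_iso) coarse_homeomorphism_ex: "\<exists>\<phi> :: 'a \<Rightarrow> 'b. coarse_homeomorphism \<phi>"
proof -
  interpret inv: so_lattice_iso M L S T by (rule inverse_iso)
  obtain \<phi> where \<phi>: "\<And>x. corresponds x (\<phi> x)" using corresponds_ex1 by metis
  obtain \<psi> where \<psi>: "\<And>y. inv.corresponds y (\<psi> y)" using inv.corresponds_ex1 by metis
  have \<phi>_iff: "\<phi> x = y \<longleftrightarrow> corresponds x y" for x y using \<phi> corresponds_unique by blast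
  have \<psi>_iff: "\<psi> y = x \<longleftrightarrow> inv.corresponds y x" for x y using \<psi> inv.corresponds_unique by blast
  have id: "\<psi> (\<phi> x) = x" "\<phi> (\<psi> y) = y" for x y
    using \<phi> \<psi> by (simp_all add: \<phi>_iff \<psi>_iff corresponds_inverse)
  have c: "continuous_on UNIV \<phi>" "continuous_on UNIV \<psi>"
    using corresponds_continuous[OF \<phi>] inv.corresponds_continuous[OF \<psi>] .
  have ue: "uniformly_expansive \<phi>" "uniformly_expansive \<psi>"
    using corresponds_bounded_on_scales[OF c(2) id(1) \<phi>_iff]
      inv.corresponds_bounded_on_scales[OF c(1) id(2) \<psi>_iff]
    by (auto intro: uniformly_expansiveI)
  have sub: "\<phi> -` B \<subseteq> \<psi> ` B" "\<psi> -` C \<subseteq> \<phi> ` C" for B C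
  proof -
    have "\<psi> (\<phi> x) \<in> \<psi> ` B" if "\<phi> x \<in> B" for x using that by blast
    then show "\<phi> -` B \<subseteq> \<psi> ` B" unfolding id by blast
    have "\<phi> (\<psi> y) \<in> \<phi> ` C" if "\<psi> y \<in> C" for y using that by blast
    then show "\<psi> -` C \<subseteq> \<phi> ` C" unfolding id by blast
  qed
  have "metrically_proper \<phi>" "metrically_proper \<psi>"
    unfolding metrically_proper_def
    by (auto intro: bounded_subset[OF proper_bounded_image[OF proper_Y c(2)] sub(1)]
        bounded_subset[OF proper_bounded_image[OF proper_X c(1)] sub(2)])
  moreover have "homeomorphism UNIV UNIV \<phi> \<psi>"
    by (rule homeomorphismI) (use c id in auto)
  ultimately show ?thesis
    unfolding coarse_homeomorphism_def coarse_map_def using ue by blast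
qed



section \<open>From lattice isomorphisms to coarse homeomorphisms\<close>

lemma chain_connected_close_neighbours:
  assumes "chain_connected (UNIV :: 'a::metric_space set)" "\<not> bounded (UNIV :: 'a set)"
  shows "\<exists>\<rho>. has_close_neighbours \<rho> TYPE('a)"
proof -
  obtain r where r: "r_chain_connected r (UNIV :: 'a set)" using assms(1) by (auto simp: chain_connected_def)
  have "\<exists>y'. y' \<noteq> y \<and> dist y y' \<le> r" for y :: 'a
  proof -
    have "\<exists>z. z \<noteq> y"
    proof (rule ccontr)
      assume "\<nexists>z. z \<noteq> y"
      then have "UNIV = {y}" by blast
      then show False using assms(2) finite_imp_bounded[of "{y}"] by (metis finite.emptyI finite_insert)
    qed
    then obtain z where "z \<noteq> y" by blast
    obtain n p where p: "p (0::nat) = y" "p n = z" "\<forall>i\<in>{1..n}. dist (p (i - 1)) (p i) \<le> r"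
      using r unfolding r_chain_connected_def by (metis UNIV_I)
    define k where "k = (LEAST i. p i \<noteq> y)"
    have k: "p k \<noteq> y" unfolding k_def by (rule LeastI[of _ n]) (simp add: p \<open>z \<noteq> y\<close>)
    have "k \<le> n" unfolding k_def by (rule Least_le) (simp add: p \<open>z \<noteq> y\<close>)
    have "k \<noteq> 0" using k p(1) by metis
    then have "p (k - 1) = y" using not_less_Least[of "k - 1" "\<lambda>i. p i \<noteq> y"] by (simp add: k_def)
    then have "dist y (p k) \<le> r" using p(3) \<open>k \<le> n\<close> \<open>k \<noteq> 0\<close> by force
    then show ?thesis using k by blast
  qed
  then show ?thesis unfolding has_close_neighbours_def by blast
qed

text \<open>
  Translation by the function \<open>T 0\<close> is an automorphism of \<open>M\<close>, so \<open>T\<close> may be normalised to fix 0.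
\<close>

lemma lattice_isomorphic_imp_coarse_homeomorphism:
  fixes L :: "('a::metric_space \<Rightarrow> real) set" and M :: "('b::metric_space \<Rightarrow> real) set"
  assumes pX: "proper_space TYPE('a)" and pY: "proper_space TYPE('b)"
    and nX: "\<exists>\<rho>. has_close_neighbours \<rho> TYPE('a)" and nY: "\<exists>\<rho>. has_close_neighbours \<rho> TYPE('b)"
    and L: "osc_lattice L" and M: "osc_lattice M" and "lattice_isomorphic L M"
  shows "\<exists>\<phi> :: 'a \<Rightarrow> 'b. coarse_homeomorphism \<phi>"
proof -
  obtain T where T: "bij_betw T L M" "\<And>f g. f \<in> L \<Longrightarrow> g \<in> L \<Longrightarrow> T (inf f g) = inf (T f) (T g)"
    using assms(7) unfolding lattice_isomorphic_def by blast
  define T0 where "T0 = T (\<lambda>_. 0)"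
  define T' where "T' = (\<lambda>f y. T f y - T0 y)"
  define S' where "S' = (\<lambda>g. inv_into L T (\<lambda>y. g y + T0 y))"
  have z: "(\<lambda>_. 0) \<in> L" using L const_SO_bounded by (auto simp: osc_lattice_def)
  have T_in: "T f \<in> M" if "f \<in> L" for f using T(1) that by (rule bij_betwE[rule_format])
  have add: "(\<lambda>y. f y + g y) \<in> M" if "f \<in> M" "g \<in> M" for f g
    using M that unfolding osc_lattice_def by blast
  have diff: "(\<lambda>y. f y - g y) \<in> M" if "f \<in> M" "g \<in> M" for f g
  proof -
    have "(\<lambda>y. - 1 * g y) \<in> M" using M that(2) unfolding osc_lattice_def by blast
    from add[OF that(1) this] show ?thesis by simp
  qed
  have T0: "T0 \<in> M" unfolding T0_def by (rule T_in[OF z])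
  interpret so_lattice_iso L M T' S'
  proof
    show "T' f \<in> M" if "f \<in> L" for f unfolding T'_def by (rule diff[OF T_in[OF that] T0])
    show "S' g \<in> L" if "g \<in> M" for g
      unfolding S'_def using add[OF that T0] T(1) by (metis bij_betw_def inv_into_into)
    show "S' (T' f) = f" if "f \<in> L" for f
      unfolding S'_def T'_def using that T(1) by (simp add: bij_betw_inv_into_left)
    show "T' (S' g) = g" if "g \<in> M" for g
      unfolding S'_def T'_def using add[OF that T0] T(1) by (simp add: bij_betw_inv_into_right)
    show "T' (inf f f') = inf (T' f) (T' f')" if "f \<in> L" "f' \<in> L" for f f'
      unfolding T'_def T(2)[OF that] by (simp add: fun_eq_iff inf_min min_def)
    show "T' (\<lambda>_. 0) = (\<lambda>_. 0)" by (simp add: T'_def T0_def)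
  qed (use assms in auto)
  show ?thesis by (rule coarse_homeomorphism_ex)
qed

section \<open>Composition with coarse homeomorphisms\<close>

lemma SO_compose_coarse:
  fixes f :: "'a::metric_space \<Rightarrow> real" and g :: "'b::metric_space \<Rightarrow> 'a"
  assumes "proper_space TYPE('a)" "proper_space TYPE('b)" "f \<in> SO" "coarse_map g" "continuous_on UNIV g"
  shows "f \<circ> g \<in> SO"
proof (rule SO_I[OF assms(2)])
  show "continuous_on UNIV (f \<circ> g)"
    by (rule continuous_on_compose[OF assms(5)]) (rule continuous_on_subset[OF SO_continuous[OF assms(3)]], simp)
  fix R \<epsilon> :: real assume R: "R > 0" and e: "\<epsilon> > 0"
  obtain \<sigma> :: "real \<Rightarrow> real" where \<sigma>: "mono_on {0..} \<sigma>" "\<And>x x'. dist (g x) (g x') \<le> \<sigma> (dist x x')"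
    using assms(4) unfolding coarse_map_def uniformly_expansive_def by blast
  have \<sigma>R: "dist (g x) (g x') \<le> \<bar>\<sigma> R\<bar> + 1" if "dist x x' \<le> R" for x x'
  proof -
    have "\<sigma> (dist x x') \<le> \<sigma> R" using \<sigma>(1) that R by (auto simp: mono_on_def)
    then show ?thesis using \<sigma>(2)[of x x'] by linarith
  qed
  have "0 < \<bar>\<sigma> R\<bar> + 1" by linarith
  then obtain K where K: "bounded K" "\<And>x y. x \<notin> K \<Longrightarrow> dist x y \<le> \<bar>\<sigma> R\<bar> + 1 \<Longrightarrow> dist (f x) (f y) < \<epsilon>"
    using SO_D[OF assms(1,3)] e by blast
  have "bounded (g -` K)" using assms(4) K(1) by (simp add: coarse_map_def metrically_proper_def)
  then show "\<exists>K. bounded K \<and> (\<forall>x y. x \<notin> K \<longrightarrow> dist x y \<le> R \<longrightarrow> dist ((f \<circ> g) x) ((f \<circ> g) y) < \<epsilon>)"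
    using K(2) \<sigma>R by (intro exI[of _ "g -` K"]) auto
qed

lemma SO_bounded_compose_coarse:
  fixes f :: "'a::metric_space \<Rightarrow> real" and g :: "'b::metric_space \<Rightarrow> 'a"
  assumes "proper_space TYPE('a)" "proper_space TYPE('b)" "f \<in> SO_bounded" "coarse_map g" "continuous_on UNIV g"
  shows "f \<circ> g \<in> SO_bounded"
proof -
  have "bounded (range (f \<circ> g))"
    using assms(3) by (auto simp: SO_bounded_def intro: bounded_subset[of "range f"])
  then show ?thesis using SO_compose_coarse[OF assms(1,2) _ assms(4,5), of f] assms(3)
    by (simp add: SO_bounded_def)
qed

lemma lattice_isomorphic_compose:
  fixes L :: "('a \<Rightarrow> real) set" and M :: "('b \<Rightarrow> real) set"
  assumes "\<And>f. f \<in> L \<Longrightarrow> f \<circ> \<psi> \<in> M" "\<And>g. g \<in> M \<Longrightarrow> g \<circ> \<phi> \<in> L"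
    and "\<And>x. \<psi> (\<phi> x) = x" "\<And>y. \<phi> (\<psi> y) = y"
  shows "lattice_isomorphic L M"
  unfolding lattice_isomorphic_def
proof (intro exI[of _ "\<lambda>f. f \<circ> \<psi>"] conjI ballI)
  show "bij_betw (\<lambda>f. f \<circ> \<psi>) L M"
    by (rule bij_betw_byWitness[where f' = "\<lambda>g. g \<circ> \<phi>"]) (use assms in \<open>auto simp: fun_eq_iff\<close>)
qed (auto simp: fun_eq_iff)

section \<open>The Higson compactification\<close>

lemma topspace_higson_product [simp]: "topspace higson_product = SO_bounded \<rightarrow>\<^sub>E UNIV"
  by (simp add: higson_product_def)

lemma higson_embedding_in [simp]: "higson_embedding x \<in> topspace higson_product"
  by (simp add: higson_embedding_def)

lemma topspace_higson: "topspace higson_compactification = higson_product closure_of range higson_embedding"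
  using closure_of_subset_topspace[of higson_product "range higson_embedding"]
  by (auto simp: higson_compactification_def)

lemma topspace_higson_subset: "topspace higson_compactification \<subseteq> SO_bounded \<rightarrow>\<^sub>E UNIV"
  using closure_of_subset_topspace[of higson_product "range higson_embedding"]
  by (simp add: topspace_higson)

lemma higson_embedding_in_higson: "higson_embedding x \<in> topspace higson_compactification"
proof -
  have "range higson_embedding \<subseteq> higson_product closure_of range higson_embedding"
    by (rule closure_of_subset) (auto simp del: topspace_higson_product)
  then show ?thesis by (auto simp: topspace_higson)
qed

lemma compact_higson: "compact_space higson_compactification"
proof -
  have "compact_space (higson_product :: (('a::metric_space \<Rightarrow> real) \<Rightarrow> ereal) topology)"
  proof -
    have "compact_space (euclidean :: ereal topology)"
      by (simp add: compact_space_def compact_UNIV)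
    then show ?thesis unfolding higson_product_def compact_space_product_topology by simp
  qed
  then show ?thesis
    unfolding higson_compactification_def
    by (intro compact_space_subtopology closedin_compact_space) auto
qed

text \<open>
  The image of \<open>X\<close> is dense in \<open>hX\<close>.
\<close>

lemma higson_agree:
  fixes p :: "('a::metric_space \<Rightarrow> real) \<Rightarrow> ereal"
  assumes "continuous_map higson_compactification Z u" "continuous_map higson_compactification Z v"
    and "Hausdorff_space Z" and "\<And>x. u (higson_embedding x) = v (higson_embedding x)"
    and "p \<in> topspace higson_compactification"
  shows "u p = v p"
proof (rule forall_in_closure_of_eq[OF _ assms(3,1,2)])
  have "range higson_embedding \<subseteq> higson_product closure_of range higson_embedding"
    using higson_embedding_in_higson by (auto simp: topspace_higson)
  then have "higson_product closure_of range higson_embedding \<inter> range higson_embedding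
      = (range higson_embedding :: (('a \<Rightarrow> real) \<Rightarrow> ereal) set)" by blast
  then have "higson_compactification closure_of range higson_embedding
      = higson_product closure_of range (higson_embedding :: 'a \<Rightarrow> _)"
    unfolding higson_compactification_def closure_of_subtopology by simp
  then show "p \<in> higson_compactification closure_of range higson_embedding"
    using assms(5) by (simp add: topspace_higson)
qed (use assms(4) in auto)

text \<open>
  The continuous extension of \<open>f\<close> to the compactification.
\<close>

definition higson_coord :: "('a::metric_space \<Rightarrow> real) \<Rightarrow> (('a \<Rightarrow> real) \<Rightarrow> ereal) \<Rightarrow> real" where
  "higson_coord f p = real_of_ereal (p f)"

lemma higson_coord_embedding [simp]:
  "f \<in> SO_bounded \<Longrightarrow> higson_coord f (higson_embedding x) = f x"
  by (simp add: higson_coord_def higson_embedding_def)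

lemma continuous_map_higson_projection:
  assumes "f \<in> SO_bounded" shows "continuous_map higson_compactification euclidean (\<lambda>p. p f)"
  unfolding higson_compactification_def higson_product_def
  by (intro continuous_map_from_subtopology continuous_map_product_projection assms)

text \<open>
  A bounded \<open>f\<close> takes values in a compact interval of reals, which the closure cannot leave; so the
  infinite values of the coordinates are never attained.
\<close>

lemma higson_finite:
  assumes f: "f \<in> SO_bounded" and p: "p \<in> topspace higson_compactification"
  shows "\<bar>p f\<bar> \<noteq> \<infinity>"
proof -
  obtain B where B: "\<And>x. \<bar>f x\<bar> \<le> B"
    using f unfolding SO_bounded_def bounded_iff by auto
  have "(\<lambda>p. p f) ` (topspace higson_compactification) \<subseteq> {ereal (- B)..ereal B}"
  proof -
    have "closedin higson_product {q \<in> topspace higson_product. q f \<in> {ereal (- B)..ereal B}}"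
      unfolding higson_product_def
      by (rule closedin_continuous_map_preimage[OF continuous_map_product_projection[OF f]]) simp
    moreover have "range higson_embedding \<subseteq> {q \<in> topspace higson_product. q f \<in> {ereal (- B)..ereal B}}"
    proof -
      have "- B \<le> f x \<and> f x \<le> B" for x using B[of x] by (simp add: abs_le_iff)
      then show ?thesis using f by (auto simp: higson_embedding_def)
    qed
    ultimately have "higson_product closure_of range higson_embedding
        \<subseteq> {q \<in> topspace higson_product. q f \<in> {ereal (- B)..ereal B}}"
      by (rule closure_of_minimal[rotated])
    then show ?thesis by (auto simp: topspace_higson)
  qed
  then have "ereal (- B) \<le> p f" "p f \<le> ereal B" using p by auto
  then show ?thesis by (cases "p f") auto
qed

lemma continuous_map_higson_coord:
  assumes "f \<in> SO_bounded"
  shows "continuous_map higson_compactification euclideanreal (higson_coord f)"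
proof -
  have "continuous_map higson_compactification (top_of_set (UNIV - {\<infinity>, -\<infinity>})) (\<lambda>p. p f)"
    using continuous_map_higson_projection[OF assms] higson_finite[OF assms]
    by (fastforce simp: continuous_map_in_subtopology)
  moreover have "continuous_map (top_of_set (UNIV - {\<infinity>, -\<infinity>})) euclideanreal real_of_ereal"
    using continuous_on_real by simp
  ultimately show ?thesis
    unfolding higson_coord_def by (rule continuous_map_compose[unfolded o_def])
qed

lemma continuous_map_higson_embedding:
  "continuous_map euclidean higson_compactification (higson_embedding :: 'a::metric_space \<Rightarrow> _)"
proof -
  have "continuous_map euclidean higson_product (higson_embedding :: 'a \<Rightarrow> _)"
    unfolding higson_product_def continuous_map_componentwise
  proof (intro conjI ballI)
    fix f :: "'a \<Rightarrow> real" assume f: "f \<in> SO_bounded"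
    then have "continuous_on UNIV f" by (simp add: SO_bounded_def SO_continuous)
    then have "continuous_on UNIV (\<lambda>x. ereal (f x))" by (intro continuous_intros)
    then show "continuous_map euclidean euclidean (\<lambda>x. higson_embedding x f)"
      using f by (simp add: higson_embedding_def)
  qed (auto simp: higson_embedding_def)
  then show ?thesis
    unfolding higson_compactification_def continuous_map_in_subtopology
    using higson_embedding_in_higson by (auto simp: topspace_higson)
qed

lemma higson_coord_separates:
  fixes p q :: "('a::metric_space \<Rightarrow> real) \<Rightarrow> ereal"
  assumes "p \<in> topspace higson_compactification" "q \<in> topspace higson_compactification"
    and "\<And>f. f \<in> SO_bounded \<Longrightarrow> higson_coord f p = higson_coord f q"
  shows "p = q"
proof (rule PiE_ext)
  show "p \<in> SO_bounded \<rightarrow>\<^sub>E UNIV" "q \<in> SO_bounded \<rightarrow>\<^sub>E UNIV"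
    using assms(1,2) topspace_higson_subset by auto
  fix f :: "'a \<Rightarrow> real" assume f: "f \<in> SO_bounded"
  have "ereal (real_of_ereal (p f)) = ereal (real_of_ereal (q f))"
    using assms(3)[OF f] by (simp add: higson_coord_def)
  then show "p f = q f"
    using higson_finite[OF f assms(1)] higson_finite[OF f assms(2)] by (simp add: ereal_real)
qed

text \<open>
  The pairs of points of \<open>hX\<close> at which \<open>G\<close> differs by at least \<open>\<epsilon>\<close> form a compact set, and each such
  pair is separated by a coordinate \<open>f\<close> by more than some \<open>\<delta>\<close>. Finitely many pairs \<open>(f, \<delta>)\<close> suffice, so
  outside the union of their exceptional sets \<open>G\<close> oscillates by less than \<open>\<epsilon>\<close>.
\<close>

lemma continuous_higson_restrict:
  fixes G :: "(('a::metric_space \<Rightarrow> real) \<Rightarrow> ereal) \<Rightarrow> real"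
  assumes "proper_space TYPE('a)"
    and G: "continuous_map higson_compactification euclideanreal G"
  shows "G \<circ> higson_embedding \<in> SO_bounded"
proof -
  define H :: "(('a \<Rightarrow> real) \<Rightarrow> ereal) topology" where "H = higson_compactification"
  have G: "continuous_map H euclideanreal G" using assms(2) by (simp add: H_def)
  have cont: "continuous_on UNIV (G \<circ> higson_embedding)"
    using continuous_map_compose[OF continuous_map_higson_embedding assms(2)] by simp
  have diff: "continuous_map (prod_topology H H) euclideanreal (\<lambda>z. \<bar>g (fst z) - g (snd z)\<bar>)"
    if "continuous_map H euclideanreal g" for g
    using continuous_map_compose[OF continuous_map_fst that] continuous_map_compose[OF continuous_map_snd that]
    by (intro continuous_map_real_abs continuous_map_diff) (simp_all add: o_def)
  have "G \<circ> higson_embedding \<in> SO"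
  proof (rule SO_I[OF assms(1) cont])
    fix R \<epsilon> :: real assume R: "R > 0" and e: "\<epsilon> > 0"
    define C where "C = {z \<in> topspace (prod_topology H H). \<bar>G (fst z) - G (snd z)\<bar> \<in> {\<epsilon>..}}"
    have "closedin (prod_topology H H) C"
      unfolding C_def by (rule closedin_continuous_map_preimage[OF diff[OF G]]) simp
    moreover have "compact_space (prod_topology H H)"
      by (simp add: H_def compact_space_prod_topology compact_higson)
    ultimately have C: "compactin (prod_topology H H) C" by (rule closedin_compact_space[rotated])
    define U where "U = (\<lambda>(f, \<delta>). {z \<in> topspace (prod_topology H H).
        \<bar>higson_coord f (fst z) - higson_coord f (snd z)\<bar> \<in> {\<delta><..}})"
    define I :: "(('a \<Rightarrow> real) \<times> real) set" where "I = SO_bounded \<times> {0<..}"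
    have opn: "openin (prod_topology H H) (U i)" if i: "i \<in> I" for i
    proof -
      obtain f \<delta> where f: "i = (f, \<delta>)" "f \<in> SO_bounded" using i unfolding I_def by blast
      show ?thesis unfolding U_def f(1) prod.case
        by (rule openin_continuous_map_preimage[OF diff]) (use f(2) in \<open>simp_all add: continuous_map_higson_coord H_def\<close>)
    qed
    have cover: "C \<subseteq> \<Union>(U ` I)"
    proof
      fix z assume z: "z \<in> C"
      obtain p q where pq: "z = (p, q)" by (cases z)
      have top: "p \<in> topspace H" "q \<in> topspace H" using z by (auto simp: C_def pq)
      have "p \<noteq> q" using z e by (auto simp: C_def pq)
      then obtain f where f: "f \<in> SO_bounded" "higson_coord f p \<noteq> higson_coord f q"
        using higson_coord_separates[of p q] top by (auto simp: H_def)
      define \<delta> where "\<delta> = \<bar>higson_coord f p - higson_coord f q\<bar> / 2"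
      have "\<delta> > 0" "\<delta> < \<bar>higson_coord f p - higson_coord f q\<bar>" using f(2) by (auto simp: \<delta>_def)
      then have "z \<in> U (f, \<delta>)" "(f, \<delta>) \<in> I" using top f(1) by (auto simp: U_def I_def pq)
      then show "z \<in> \<Union>(U ` I)" by blast
    qed
    obtain \<F> where \<F>: "finite \<F>" "\<F> \<subseteq> U ` I" "C \<subseteq> \<Union>\<F>"
      using compactinD[OF C _ cover] opn by blast
    obtain J where J: "J \<subseteq> I" "finite J" "\<F> = U ` J"
      using finite_subset_image[OF \<F>(1,2)] by blast
    have "\<exists>K. bounded K \<and> (\<forall>x y. x \<notin> K \<longrightarrow> dist x y \<le> R \<longrightarrow> dist (fst i x) (fst i y) < snd i)" if "i \<in> I" for i
    proof -
      have "fst i \<in> SO" "0 < snd i" using that by (auto simp: I_def SO_bounded_def)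
      then show ?thesis using SO_D[OF assms(1) _ R] by metis
    qed
    then obtain K where K: "\<And>i. i \<in> I \<Longrightarrow> bounded (K i)"
      "\<And>i x y. i \<in> I \<Longrightarrow> x \<notin> K i \<Longrightarrow> dist x y \<le> R \<Longrightarrow> dist (fst i x) (fst i y) < snd i"
      by metis
    have "dist ((G \<circ> higson_embedding) x) ((G \<circ> higson_embedding) y) < \<epsilon>"
      if x: "x \<notin> (\<Union>i\<in>J. K i)" "dist x y \<le> R" for x y
    proof (rule ccontr)
      assume "\<not> ?thesis"
      then have "(higson_embedding x, higson_embedding y) \<in> C"
        by (auto simp: C_def H_def higson_embedding_in_higson dist_real_def)
      then obtain i where i: "i \<in> J" "(higson_embedding x, higson_embedding y) \<in> U i"
        using \<F>(3) J(3) by blast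
      obtain f \<delta> where f: "i = (f, \<delta>)" "f \<in> SO_bounded" using i(1) J(1) unfolding I_def by blast
      have "\<delta> < dist (f x) (f y)" using i(2) f by (simp add: U_def dist_real_def)
      moreover have "dist (f x) (f y) < \<delta>" using K(2)[of i x y] i(1) J(1) x f(1) by auto
      ultimately show False by simp
    qed
    moreover have "bounded (\<Union>i\<in>J. K i)" using J(1,2) K(1) by (intro bounded_UN) auto
    ultimately show "\<exists>K. bounded K \<and> (\<forall>x y. x \<notin> K \<longrightarrow> dist x y \<le> R \<longrightarrow>
        dist ((G \<circ> higson_embedding) x) ((G \<circ> higson_embedding) y) < \<epsilon>)" by blast
  qed
  moreover have "bounded (range (G \<circ> higson_embedding))"
  proof -
    have "compactin euclideanreal (G ` topspace H)"
      using compact_higson G unfolding H_def compact_space_def by (rule image_compactin)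
    then have "bounded (G ` topspace H)" by (simp add: compact_imp_bounded)
    then show ?thesis
      by (rule bounded_subset) (auto simp: H_def higson_embedding_in_higson)
  qed
  ultimately show ?thesis by (simp add: SO_bounded_def)
qed

text \<open>
  Extend to \<open>hX\<close>, transport along the homeomorphism, restrict to \<open>Y\<close>. By density the
  extension of the transported function is the transported extension, so the reverse procedure is
  inverse to this one.
\<close>

lemma higson_homeomorphic_imp_lattice_isomorphic:
  assumes "proper_space TYPE('a::metric_space)" "proper_space TYPE('b::metric_space)"
    and "(higson_compactification :: (('a \<Rightarrow> real) \<Rightarrow> ereal) topology) homeomorphic_space
      (higson_compactification :: (('b \<Rightarrow> real) \<Rightarrow> ereal) topology)"
  shows "lattice_isomorphic (SO_bounded :: ('a \<Rightarrow> real) set) (SO_bounded :: ('b \<Rightarrow> real) set)"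
proof -
  define hX where "hX = (higson_compactification :: (('a \<Rightarrow> real) \<Rightarrow> ereal) topology)"
  define hY where "hY = (higson_compactification :: (('b \<Rightarrow> real) \<Rightarrow> ereal) topology)"
  obtain h k where hk: "homeomorphic_maps hX hY h k"
    using assms(3) unfolding homeomorphic_space_def hX_def hY_def by blast
  then have h: "continuous_map hX hY h" and k: "continuous_map hY hX k"
    and kh: "\<And>p. p \<in> topspace hX \<Longrightarrow> k (h p) = p" and hk': "\<And>q. q \<in> topspace hY \<Longrightarrow> h (k q) = q"
    by (auto simp: homeomorphic_maps_def)
  define T where "T = (\<lambda>f :: 'a \<Rightarrow> real. higson_coord f \<circ> k \<circ> higson_embedding)"
  define S where "S = (\<lambda>g :: 'b \<Rightarrow> real. higson_coord g \<circ> h \<circ> higson_embedding)"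
  have cT: "continuous_map hY euclideanreal (higson_coord f \<circ> k)" if "f \<in> SO_bounded" for f
    using continuous_map_compose[OF k] continuous_map_higson_coord[OF that] by (simp add: hX_def)
  have cS: "continuous_map hX euclideanreal (higson_coord g \<circ> h)" if "g \<in> SO_bounded" for g
    using continuous_map_compose[OF h] continuous_map_higson_coord[OF that] by (simp add: hY_def)
  have T_in: "T f \<in> SO_bounded" if "f \<in> SO_bounded" for f
    unfolding T_def using continuous_higson_restrict[OF assms(2)] cT[OF that] by (simp add: hY_def)
  have S_in: "S g \<in> SO_bounded" if "g \<in> SO_bounded" for g
    unfolding S_def using continuous_higson_restrict[OF assms(1)] cS[OF that] by (simp add: hX_def)
  have Haus: "Hausdorff_space euclideanreal" by simp
  have ext_T: "higson_coord (T f) q = higson_coord f (k q)" if f: "f \<in> SO_bounded" and q: "q \<in> topspace hY" for f q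
  proof -
    have "higson_coord (T f) q = (higson_coord f \<circ> k) q"
      by (rule higson_agree[OF continuous_map_higson_coord[OF T_in[OF f]] cT[OF f, unfolded hY_def] Haus _
            q[unfolded hY_def]])
         (use T_in[OF f] in \<open>simp add: T_def\<close>)
    then show ?thesis by simp
  qed
  have ext_S: "higson_coord (S g) p = higson_coord g (h p)" if g: "g \<in> SO_bounded" and p: "p \<in> topspace hX" for g p
  proof -
    have "higson_coord (S g) p = (higson_coord g \<circ> h) p"
      by (rule higson_agree[OF continuous_map_higson_coord[OF S_in[OF g]] cS[OF g, unfolded hX_def] Haus _
            p[unfolded hX_def]])
         (use S_in[OF g] in \<open>simp add: S_def\<close>)
    then show ?thesis by simp
  qed
  have eX: "higson_embedding x \<in> topspace hX" for x by (simp add: hX_def higson_embedding_in_higson)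
  have eY: "higson_embedding y \<in> topspace hY" for y by (simp add: hY_def higson_embedding_in_higson)
  have hX_in: "h p \<in> topspace hY" if "p \<in> topspace hX" for p
    using h that by (auto simp: continuous_map_def)
  have kY_in: "k q \<in> topspace hX" if "q \<in> topspace hY" for q
    using k that by (auto simp: continuous_map_def)
  have ST: "S (T f) = f" if "f \<in> SO_bounded" for f
    by (simp add: S_def fun_eq_iff ext_T[OF that hX_in[OF eX]] kh[OF eX] that)
  have TS: "T (S g) = g" if "g \<in> SO_bounded" for g
    by (simp add: T_def fun_eq_iff ext_S[OF that kY_in[OF eY]] hk'[OF eY] that)
  have sup_in: "sup f g \<in> SO_bounded" if "f \<in> SO_bounded" "g \<in> SO_bounded" for f g :: "'a \<Rightarrow> real"
  proof -
    have scale: "(\<lambda>x. - 1 * u x) \<in> SO_bounded" if "u \<in> SO_bounded" for u :: "'a \<Rightarrow> real"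
      using osc_lattice_SO_bounded[OF assms(1)] that unfolding osc_lattice_def by blast
    have "inf (\<lambda>x. - 1 * f x) (\<lambda>x. - 1 * g x) \<in> SO_bounded"
      using osc_lattice_SO_bounded[OF assms(1)] scale[OF that(1)] scale[OF that(2)]
      unfolding osc_lattice_def by blast
    from scale[OF this] show ?thesis
      by (rule back_subst[where P = "\<lambda>u. u \<in> SO_bounded"]) (auto simp: fun_eq_iff inf_min sup_max min_def max_def)
  qed
  have inf_in: "inf f g \<in> SO_bounded" if "f \<in> SO_bounded" "g \<in> SO_bounded" for f g :: "'a \<Rightarrow> real"
    using osc_lattice_SO_bounded[OF assms(1)] that unfolding osc_lattice_def by blast
  have coord_sup: "higson_coord (sup f g) p = max (higson_coord f p) (higson_coord g p)"
    and coord_inf: "higson_coord (inf f g) p = min (higson_coord f p) (higson_coord g p)"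
    if "f \<in> SO_bounded" "g \<in> SO_bounded" "p \<in> topspace hX" for f g p
  proof -
    note coord = continuous_map_higson_coord[OF that(1)] continuous_map_higson_coord[OF that(2)]
    show "higson_coord (sup f g) p = max (higson_coord f p) (higson_coord g p)"
      by (rule higson_agree[OF continuous_map_higson_coord[OF sup_in[OF that(1,2)]]
            continuous_map_real_max[OF coord] Haus _ that(3)[unfolded hX_def]])
         (use that in \<open>simp add: sup_in sup_max\<close>)
    show "higson_coord (inf f g) p = min (higson_coord f p) (higson_coord g p)"
      by (rule higson_agree[OF continuous_map_higson_coord[OF inf_in[OF that(1,2)]]
            continuous_map_real_min[OF coord] Haus _ that(3)[unfolded hX_def]])
         (use that in \<open>simp add: inf_in inf_min\<close>)
  qed
  have "T (sup f g) = sup (T f) (T g)" "T (inf f g) = inf (T f) (T g)"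
    if "f \<in> SO_bounded" "g \<in> SO_bounded" for f g
    using that coord_sup coord_inf kY_in[OF eY] by (simp_all add: T_def fun_eq_iff sup_max inf_min)
  moreover have "bij_betw T SO_bounded SO_bounded"
    by (rule bij_betw_byWitness[where f' = S]) (use ST TS T_in S_in in auto)
  ultimately show ?thesis unfolding lattice_isomorphic_def by blast
qed

text \<open>
  A continuous coarse map \<open>h\<close> induces \<open>p \<mapsto> (g \<mapsto> p (g \<circ> h))\<close> on the products. Each coordinate of the image is
  a coordinate of \<open>p\<close>, so this is continuous, and it takes the point of \<open>hX\<close> given by \<open>x\<close> to the one given by the image of \<open>x\<close>.
\<close>

lemma coarse_homeomorphism_imp_higson_homeomorphic:
  fixes \<phi> :: "'a::metric_space \<Rightarrow> 'b::metric_space"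
  assumes "proper_space TYPE('a)" "proper_space TYPE('b)" "coarse_homeomorphism \<phi>"
  shows "(higson_compactification :: (('a \<Rightarrow> real) \<Rightarrow> ereal) topology) homeomorphic_space
      (higson_compactification :: (('b \<Rightarrow> real) \<Rightarrow> ereal) topology)"
proof -
  have pull: "continuous_map higson_compactification higson_compactification
      (\<lambda>p. \<lambda>g\<in>SO_bounded. p (g \<circ> h))"
    if h: "coarse_map h" "continuous_on UNIV h" and px: "proper_space TYPE('c)" "proper_space TYPE('d)"
    for h :: "'c::metric_space \<Rightarrow> 'd::metric_space"
  proof -
    let ?H = "\<lambda>p :: ('c \<Rightarrow> real) \<Rightarrow> ereal. \<lambda>g\<in>SO_bounded. p (g \<circ> h)"
    have in_SO: "g \<circ> h \<in> SO_bounded" if "g \<in> SO_bounded" for g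
      using SO_bounded_compose_coarse[OF px(2,1) that h] .
    have c: "continuous_map higson_product higson_product ?H"
      unfolding higson_product_def continuous_map_componentwise
      using in_SO by (auto intro: continuous_map_product_projection)
    have "?H (higson_embedding x) = higson_embedding (h x)" for x
      using in_SO by (auto simp: higson_embedding_def fun_eq_iff)
    then have "?H ` range higson_embedding \<subseteq> range higson_embedding" by auto
    then have "?H ` (higson_product closure_of range higson_embedding)
        \<subseteq> higson_product closure_of range higson_embedding"
      using continuous_map_image_closure_subset[OF c] closure_of_mono by blast
    then show ?thesis
      unfolding higson_compactification_def
      by (intro continuous_map_into_subtopology continuous_map_from_subtopology c) auto
  qed
  obtain \<psi> where \<psi>: "homeomorphism UNIV UNIV \<phi> \<psi>" "coarse_map \<phi>" "coarse_map \<psi>"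
    using assms(3) by (auto simp: coarse_homeomorphism_def)
  then have c: "continuous_on UNIV \<phi>" "continuous_on UNIV \<psi>" and id: "\<And>x. \<psi> (\<phi> x) = x" "\<And>y. \<phi> (\<psi> y) = y"
    by (auto simp: homeomorphism_def)
  have comp: "g \<circ> \<phi> \<circ> \<psi> = g" "f \<circ> \<psi> \<circ> \<phi> = f" for f :: "'a \<Rightarrow> real" and g :: "'b \<Rightarrow> real"
    by (simp_all add: fun_eq_iff id)
  have in_SO: "g \<circ> \<phi> \<in> SO_bounded" if "g \<in> SO_bounded" for g
    using SO_bounded_compose_coarse[OF assms(2,1) that \<psi>(2) c(1)] .
  have in_SO': "f \<circ> \<psi> \<in> SO_bounded" if "f \<in> SO_bounded" for f
    using SO_bounded_compose_coarse[OF assms(1,2) that \<psi>(3) c(2)] .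
  have "(\<lambda>f\<in>SO_bounded. (\<lambda>g\<in>SO_bounded. p (g \<circ> \<phi>)) (f \<circ> \<psi>)) = p"
    if "p \<in> topspace higson_compactification" for p :: "('a \<Rightarrow> real) \<Rightarrow> ereal"
  proof (rule PiE_ext)
    show "p \<in> SO_bounded \<rightarrow>\<^sub>E UNIV" using that topspace_higson_subset by auto
  qed (simp_all add: in_SO' comp)
  moreover have "(\<lambda>g\<in>SO_bounded. (\<lambda>f\<in>SO_bounded. p (f \<circ> \<psi>)) (g \<circ> \<phi>)) = p"
    if "p \<in> topspace higson_compactification" for p :: "('b \<Rightarrow> real) \<Rightarrow> ereal"
  proof (rule PiE_ext)
    show "p \<in> SO_bounded \<rightarrow>\<^sub>E UNIV" using that topspace_higson_subset by auto
  qed (simp_all add: in_SO comp)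
  ultimately show ?thesis
    unfolding homeomorphic_space_def homeomorphic_maps_def
    using pull[OF \<psi>(2) c(1) assms(1,2)] pull[OF \<psi>(3) c(2) assms(2,1)] by blast
qed

section \<open>The four equivalent conditions\<close>

theorem theorem4p5:
  assumes "proper_space TYPE('a::metric_space)"
    and "proper_space TYPE('b::metric_space)"
    and "chain_connected (UNIV :: 'a set)"
    and "chain_connected (UNIV :: 'b set)"
    and "\<not> bounded (UNIV :: 'a set)"
    and "\<not> bounded (UNIV :: 'b set)"
  shows "(lattice_isomorphic (SO :: ('a \<Rightarrow> real) set) (SO :: ('b \<Rightarrow> real) set)
            \<longleftrightarrow> lattice_isomorphic (SO_bounded :: ('a \<Rightarrow> real) set) (SO_bounded :: ('b \<Rightarrow> real) set))
       \<and> (lattice_isomorphic (SO_bounded :: ('a \<Rightarrow> real) set) (SO_bounded :: ('b \<Rightarrow> real) set)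
            \<longleftrightarrow> (\<exists>f :: 'a \<Rightarrow> 'b. coarse_homeomorphism f))
       \<and> ((\<exists>f :: 'a \<Rightarrow> 'b. coarse_homeomorphism f)
            \<longleftrightarrow> (higson_compactification :: (('a \<Rightarrow> real) \<Rightarrow> ereal) topology) homeomorphic_space
                (higson_compactification :: (('b \<Rightarrow> real) \<Rightarrow> ereal) topology))"
    (is "(?SO \<longleftrightarrow> ?SOb) \<and> (?SOb \<longleftrightarrow> ?coarse) \<and> (?coarse \<longleftrightarrow> ?higson)")
proof -
  note proper = assms(1,2)
  note neighbours = chain_connected_close_neighbours[OF assms(3,5)] chain_connected_close_neighbours[OF assms(4,6)]
  have "?SO \<Longrightarrow> ?coarse"
    by (rule lattice_isomorphic_imp_coarse_homeomorphism[OF proper neighbours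
          osc_lattice_SO[OF proper(1)] osc_lattice_SO[OF proper(2)]])
  moreover have "?SOb \<Longrightarrow> ?coarse"
    by (rule lattice_isomorphic_imp_coarse_homeomorphism[OF proper neighbours
          osc_lattice_SO_bounded[OF proper(1)] osc_lattice_SO_bounded[OF proper(2)]])
  moreover have "?SO" "?SOb" "?higson" if coarse: ?coarse
  proof -
    obtain \<phi> :: "'a \<Rightarrow> 'b" where \<phi>: "coarse_homeomorphism \<phi>" using coarse by blast
    then obtain \<psi> where \<psi>: "homeomorphism UNIV UNIV \<phi> \<psi>" "coarse_map \<phi>" "coarse_map \<psi>"
      by (auto simp: coarse_homeomorphism_def)
    then have c: "continuous_on UNIV \<phi>" "continuous_on UNIV \<psi>" and id: "\<And>x. \<psi> (\<phi> x) = x" "\<And>y. \<phi> (\<psi> y) = y"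
      by (auto simp: homeomorphism_def)
    show ?SO
      by (rule lattice_isomorphic_compose[OF SO_compose_coarse[OF proper _ \<psi>(3) c(2)]
            SO_compose_coarse[OF proper(2,1) _ \<psi>(2) c(1)] id])
    show ?SOb
      by (rule lattice_isomorphic_compose[OF SO_bounded_compose_coarse[OF proper _ \<psi>(3) c(2)]
            SO_bounded_compose_coarse[OF proper(2,1) _ \<psi>(2) c(1)] id])
    show ?higson by (rule coarse_homeomorphism_imp_higson_homeomorphic[OF proper \<phi>])
  qed
  moreover have "?higson \<Longrightarrow> ?SOb"
    by (rule higson_homeomorphic_imp_lattice_isomorphic[OF proper])
  ultimately show ?thesis by blast
qed

end
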